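(* There is a deterministic algorithm which, starting from an empty graph on $n$ fixed vertices and provided that the graph has arboricity at most $\lambda$ at all times, maintains a maximal independent set over any sequence of edge insertions and deletions in $O(\sqrt{m\log m}\,\lambda^{3/2})$ amortized update time, where $m$ denotes the number of edge updates.
   Context: Fully dynamic MIS problem: after each single-edge insertion or deletion the algorithm must hold explicitly a maximal independent set of the current graph. The arboricity of a graph $G=(V,E)$ is $\max_{U\subseteq V,|U|\ge 2}\lceil |E(U)|/(|U|-1)\rceil$, where $E(U)$ is the set of edges induced by $U$. Amortized update time is total running time divided by the number of updates. *)

theory Defs
  imports Complex_Main
begin

section \<open>Graphs\<close>

text \<open>A simple undirected graph is given by a vertex set \<open>V\<close> and a set \<open>E\<close> of
  two-element subsets of \<open>V\<close>.\<close>

type_synonym edge = "nat set"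

definition induced_edges :: "edge set \<Rightarrow> nat set \<Rightarrow> edge set" where
  "induced_edges E U = {e \<in> E. e \<subseteq> U}"

text \<open>On \<^typ>\<open>nat\<close> a supremum over a finite nonempty set is its maximum; with fewer than two
  vertices the index set is empty and the value is 0.\<close>

definition arboricity :: "nat set \<Rightarrow> edge set \<Rightarrow> nat" where
  "arboricity V E =
     (SUP U\<in>{U. U \<subseteq> V \<and> 2 \<le> card U}.
        nat \<lceil>real (card (induced_edges E U)) / (real (card U) - 1)\<rceil>)"

definition independent_set :: "nat set \<Rightarrow> edge set \<Rightarrow> nat set \<Rightarrow> bool" where
  "independent_set V E I \<longleftrightarrow> I \<subseteq> V \<and> (\<forall>u\<in>I. \<forall>v\<in>I. {u, v} \<notin> E)"

definition maximal_independent_set :: "nat set \<Rightarrow> edge set \<Rightarrow> nat set \<Rightarrow> bool" where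
  "maximal_independent_set V E I \<longleftrightarrow>
     independent_set V E I \<and> (\<forall>J. independent_set V E J \<and> I \<subseteq> J \<longrightarrow> J = I)"


section \<open>Edge updates\<close>

datatype edge_update = Ins nat nat | Del nat nat

fun apply_update :: "edge_update \<Rightarrow> edge set \<Rightarrow> edge set" where
  "apply_update (Ins u v) E = insert {u, v} E"
| "apply_update (Del u v) E = E - {{u, v}}"

definition edges_after :: "edge_update list \<Rightarrow> edge set" where
  "edges_after us = fold apply_update us {}"

fun legal_update :: "nat \<Rightarrow> edge set \<Rightarrow> edge_update \<Rightarrow> bool" where
  "legal_update n E (Ins u v) \<longleftrightarrow> u < n \<and> v < n \<and> u \<noteq> v \<and> {u, v} \<notin> E"
| "legal_update n E (Del u v) \<longleftrightarrow> {u, v} \<in> E"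

definition legal_updates :: "nat \<Rightarrow> edge_update list \<Rightarrow> bool" where
  "legal_updates n us \<longleftrightarrow>
     (\<forall>i < length us. legal_update n (edges_after (take i us)) (us ! i))"


section \<open>A word RAM\<close>

text \<open>The machine is a random access machine presented as a structured language: finitely many
  scalar registers and zero-initialised arrays (those named in the program), with unit-cost
  arithmetic, comparison, array access and branching. All values, including array indices, have
  to be smaller than a bound \<open>W\<close>, i.e. fit into a word of \<open>log 2 W\<close> bits; a computation that
  exceeds it has no result at all.\<close>

type_synonym vname = string

datatype binop = Add | Sub | Mul | Div | Less

datatype exp =
    Const nat
  | Var vname
  | Get vname exp
  | Op binop exp exp

datatype com =
    Skip
  | Assign vname exp
  | Store vname exp exp
  | Seq com com
  | Cond exp com com
  | While exp com

record state =
  scalar :: "vname \<Rightarrow> nat"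
  arr :: "vname \<Rightarrow> nat \<Rightarrow> nat"

text \<open>\<open>Sub\<close> is truncated subtraction and \<open>Less\<close> yields 1 for true and 0 for false.\<close>

fun binop_val :: "binop \<Rightarrow> nat \<Rightarrow> nat \<Rightarrow> nat" where
  "binop_val Add x y = x + y"
| "binop_val Sub x y = x - y"
| "binop_val Mul x y = x * y"
| "binop_val Div x y = x div y"
| "binop_val Less x y = (if x < y then 1 else 0)"

fun val :: "state \<Rightarrow> exp \<Rightarrow> nat" where
  "val s (Const c) = c"
| "val s (Var x) = scalar s x"
| "val s (Get a e) = arr s a (val s e)"
| "val s (Op f e1 e2) = binop_val f (val s e1) (val s e2)"

fun fits :: "nat \<Rightarrow> state \<Rightarrow> exp \<Rightarrow> bool" where
  "fits W s (Const c) \<longleftrightarrow> c < W"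
| "fits W s (Var x) \<longleftrightarrow> scalar s x < W"
| "fits W s (Get a e) \<longleftrightarrow> fits W s e \<and> arr s a (val s e) < W"
| "fits W s (Op f e1 e2) \<longleftrightarrow>
     fits W s e1 \<and> fits W s e2 \<and> binop_val f (val s e1) (val s e2) < W"

fun cost :: "exp \<Rightarrow> nat" where
  "cost (Const c) = 1"
| "cost (Var x) = 1"
| "cost (Get a e) = cost e + 1"
| "cost (Op f e1 e2) = cost e1 + cost e2 + 1"

text \<open>\<open>exec W c s t s'\<close>: started in \<open>s\<close>, the program \<open>c\<close> terminates in \<open>s'\<close> after \<open>t\<close> steps,
  using only values below \<open>W\<close>.\<close>

inductive exec :: "nat \<Rightarrow> com \<Rightarrow> state \<Rightarrow> nat \<Rightarrow> state \<Rightarrow> bool" for W where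
  exec_Skip: "exec W Skip s 1 s"
| exec_Assign: "fits W s e \<Longrightarrow>
    exec W (Assign x e) s (cost e + 1) (s\<lparr>scalar := (scalar s)(x := val s e)\<rparr>)"
| exec_Store: "fits W s i \<Longrightarrow> fits W s e \<Longrightarrow>
    exec W (Store a i e) s (cost i + cost e + 1)
      (s\<lparr>arr := (arr s)(a := (arr s a)(val s i := val s e))\<rparr>)"
| exec_Seq: "exec W c1 s t1 s1 \<Longrightarrow> exec W c2 s1 t2 s2 \<Longrightarrow>
    exec W (Seq c1 c2) s (t1 + t2) s2"
| exec_CondTrue: "fits W s e \<Longrightarrow> val s e \<noteq> 0 \<Longrightarrow> exec W c1 s t s' \<Longrightarrow>
    exec W (Cond e c1 c2) s (cost e + 1 + t) s'"
| exec_CondFalse: "fits W s e \<Longrightarrow> val s e = 0 \<Longrightarrow> exec W c2 s t s' \<Longrightarrow>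
    exec W (Cond e c1 c2) s (cost e + 1 + t) s'"
| exec_WhileFalse: "fits W s e \<Longrightarrow> val s e = 0 \<Longrightarrow>
    exec W (While e c) s (cost e + 1) s"
| exec_WhileTrue: "fits W s e \<Longrightarrow> val s e \<noteq> 0 \<Longrightarrow> exec W c s t1 s1 \<Longrightarrow>
    exec W (While e c) s1 t2 s2 \<Longrightarrow>
    exec W (While e c) s (cost e + 1 + t1 + t2) s2"

inductive_cases exec_SkipE: "exec W Skip s t s'"
inductive_cases exec_AssignE: "exec W (Assign x e) s t s'"
inductive_cases exec_StoreE: "exec W (Store a i e) s t s'"
inductive_cases exec_SeqE: "exec W (Seq c1 c2) s t s'"
inductive_cases exec_CondE: "exec W (Cond e c1 c2) s t s'"
inductive_cases exec_WhileE: "exec W (While e c) s t s'"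

lemma exec_deterministic:
  "exec W c s t s' \<Longrightarrow> exec W c s t2 s2 \<Longrightarrow> t2 = t \<and> s2 = s'"
proof (induction arbitrary: t2 s2 rule: exec.induct)
  case (exec_Skip s)
  then show ?case by (elim exec_SkipE) simp
next
  case (exec_Assign s e x)
  from exec_Assign(2) show ?case by (elim exec_AssignE) simp
next
  case (exec_Store s i e a)
  from exec_Store(3) show ?case by (elim exec_StoreE) simp
next
  case (exec_Seq c1 s t1 s1 c2 t2 s2 t3 s3)
  from exec_Seq.prems show ?case by (rule exec_SeqE) (metis exec_Seq.IH)
next
  case (exec_CondTrue s e c1 t s' c2)
  from exec_CondTrue.prems exec_CondTrue.hyps(2)
  obtain t3 where "t2 = cost e + 1 + t3" and "exec W c1 s t3 s2"
    by (elim exec_CondE) auto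
  with exec_CondTrue.IH show ?case by metis
next
  case (exec_CondFalse s e c2 t s' c1)
  from exec_CondFalse.prems exec_CondFalse.hyps(2)
  obtain t3 where "t2 = cost e + 1 + t3" and "exec W c2 s t3 s2"
    by (elim exec_CondE) auto
  with exec_CondFalse.IH show ?case by metis
next
  case (exec_WhileFalse s e c)
  from exec_WhileFalse.prems show ?case
    by (rule exec_WhileE) (use exec_WhileFalse.hyps(2) in simp_all)
next
  case (exec_WhileTrue s e c t1 s1 t2 s2 t3 s3)
  from exec_WhileTrue.prems
  obtain t4 s4 t5 where t: "t3 = cost e + 1 + t4 + t5"
    and body: "exec W c s t4 s4" and rest: "exec W (While e c) s4 t5 s3"
    by (rule exec_WhileE) (use exec_WhileTrue.hyps(2) in auto)
  from exec_WhileTrue.IH(1)[OF body] exec_WhileTrue.IH(2) rest t show ?case by simp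
qed

lemma fits_mono: "fits W s e \<Longrightarrow> W \<le> W' \<Longrightarrow> fits W' s e"
  by (induction e) auto

text \<open>A larger word bound never changes a computation that succeeds with a smaller one, so a
  program cannot exploit the bound.\<close>

lemma exec_mono: "exec W c s t s' \<Longrightarrow> W \<le> W' \<Longrightarrow> exec W' c s t s'"
proof (induction rule: exec.induct)
  case exec_Skip
  then show ?case by (metis exec.exec_Skip fits_mono)
next
  case exec_Assign
  then show ?case by (metis exec.exec_Assign fits_mono)
next
  case exec_Store
  then show ?case by (metis exec.exec_Store fits_mono)
next
  case exec_Seq
  then show ?case by (metis exec.exec_Seq fits_mono)
next
  case exec_CondTrue
  then show ?case by (metis exec.exec_CondTrue fits_mono)
next
  case exec_CondFalse
  then show ?case by (metis exec.exec_CondFalse fits_mono)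
next
  case exec_WhileFalse
  then show ?case by (metis exec.exec_WhileFalse fits_mono)
next
  case exec_WhileTrue
  then show ?case by (metis exec.exec_WhileTrue fits_mono)
qed


section \<open>Dynamic algorithms\<close>

text \<open>A dynamic algorithm consists of a program run once at the start and a program run after
  each update. It is told the number \<open>n\<close> of vertices (the vertices are \<open>0, \<dots>, n - 1\<close>) and the
  arboricity bound, and sees the updates one at a time; it does not know their number.\<close>

record dyn_alg =
  init_com :: com
  update_com :: com

definition start_state :: "nat \<Rightarrow> nat \<Rightarrow> state" where
  "start_state n lam =
     \<lparr>scalar = (\<lambda>_. 0)(''n'' := n, ''lambda'' := lam), arr = (\<lambda>_ _. 0)\<rparr>"

fun feed :: "edge_update \<Rightarrow> state \<Rightarrow> state" where
  "feed (Ins u v) s = s\<lparr>scalar := (scalar s)(''insert'' := 1, ''u'' := u, ''v'' := v)\<rparr>"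
| "feed (Del u v) s = s\<lparr>scalar := (scalar s)(''insert'' := 0, ''u'' := u, ''v'' := v)\<rparr>"

inductive serve :: "nat \<Rightarrow> com \<Rightarrow> state \<Rightarrow> edge_update list \<Rightarrow> nat \<Rightarrow> state list \<Rightarrow> bool"
  for W c where
  serve_Nil: "serve W c s [] 0 []"
| serve_Cons: "exec W c (feed x s) t s' \<Longrightarrow> serve W c s' xs T ss \<Longrightarrow>
    serve W c s (x # xs) (t + T) (s' # ss)"

text \<open>\<open>run W A n lam us T ss\<close>: processing the updates \<open>us\<close> takes \<open>T\<close> steps in total,
  initialisation included; \<open>ss ! i\<close> is the state after the first \<open>i\<close> updates.\<close>

definition run ::
  "nat \<Rightarrow> dyn_alg \<Rightarrow> nat \<Rightarrow> nat \<Rightarrow> edge_update list \<Rightarrow> nat \<Rightarrow> state list \<Rightarrow> bool" where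
  "run W A n lam us T ss \<longleftrightarrow>
     (\<exists>t0 s0 T' ss'.
        exec W (init_com A) (start_state n lam) t0 s0 \<and>
        serve W (update_com A) s0 us T' ss' \<and>
        T = t0 + T' \<and> ss = s0 # ss')"

text \<open>The vertex set held by the algorithm is stored explicitly as an array of membership flags.
  The flag value for members is 0, the initial content of the memory: all vertices of the empty
  graph belong to its maximal independent set, and setting up \<open>n\<close> flags would take time not
  bounded in terms of the number of updates.\<close>

definition held_set :: "nat \<Rightarrow> state \<Rightarrow> nat set" where
  "held_set n s = {v. v < n \<and> arr s ''excluded'' v = 0}"

end

theory Submission
  imports Defs
begin

text \<open>
  A vertex is low until the number of its past and present neighbours exceeds
  \<open>sqrt (lam * t)\<close>, where \<open>t\<close> counts the updates so far; from then on it is heavy forever.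
  At time \<open>t\<close> there are \<open>O(sqrt (t / lam))\<close> heavy vertices: the neighbours counted at a
  promotion pay for it.

  A maximal independent set of the graph induced by the low vertices is maintained together with,
  for every vertex, the number of its low neighbours in the set. A change of membership of a low
  vertex costs \<open>O(sqrt (lam * t))\<close>, and since only the two endpoints of an update can leave the
  set, an amortized constant number of changes occurs per update. The set is extended greedily by
  heavy vertices, from scratch after each update. As the heavy vertices induce at most \<open>lam\<close>
  times their number of edges, this costs \<open>O(lam * sqrt (t / lam))\<close>. Altogether an update takes
  amortized time \<open>O(sqrt (lam * m))\<close>, which is below the claimed bound.
\<close>

text \<open>The threshold balances two costs. With threshold \<open>s\<close>, a membership change
  of a low vertex scans about \<open>s\<close> entries. The first \<open>t\<close> updates create at
  most \<open>2 * t\<close> list entries, hence \<open>O(t / s)\<close> heavy vertices, and by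
  arboricity \<open>O(lam * t / s)\<close> edges among them. The two costs agree at
  \<open>s = sqrt (lam * t)\<close>.

  Dependence runs one way: low vertices ignore heavy ones, so rebuilding the heavy part changes no
  counter. Counting past neighbours makes the lists monotone; thus no vertex ever has to be demoted,
  and a list entry pays for at most one promotion.

  The obstacle is that \<open>m\<close> is unknown. The threshold moves with \<open>t\<close>, and
  early promotions need short lists only, so dividing the number of entries by the present threshold
  proves nothing. \<open>few_heavy\<close> instead gives each entry still held by a low vertex the
  weight \<open>1 / sqrt t\<close>, which falls as time passes, and rests on
  \<open>1 / sqrt (t + 1) \<le> 2 * (sqrt (t + 1) - sqrt t)\<close>.\<close>

section \<open>Timed weakest preconditions\<close>

text \<open>The postcondition also sees the clock, which shows \<open>\<tau>\<close> at the start.\<close>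

definition wp ::
  "nat \<Rightarrow> com \<Rightarrow> ((vname \<Rightarrow> nat) \<Rightarrow> (vname \<Rightarrow> nat \<Rightarrow> nat) \<Rightarrow> nat \<Rightarrow> bool) \<Rightarrow>
    (vname \<Rightarrow> nat) \<Rightarrow> (vname \<Rightarrow> nat \<Rightarrow> nat) \<Rightarrow> nat \<Rightarrow> bool" where
  "wp W c Q S A \<tau> \<longleftrightarrow>
     (\<exists>t S' A'. exec W c \<lparr>scalar = S, arr = A\<rparr> t \<lparr>scalar = S', arr = A'\<rparr> \<and> Q S' A' (\<tau> + t))"

lemma wp_Skip: "Q S A (\<tau> + 1) \<Longrightarrow> wp W Skip Q S A \<tau>"
  unfolding wp_def by (blast intro: exec_Skip)

lemma wp_Assign:
  "fits W \<lparr>scalar = S, arr = A\<rparr> e \<Longrightarrow>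
   Q (S(x := val \<lparr>scalar = S, arr = A\<rparr> e)) A (\<tau> + (cost e + 1)) \<Longrightarrow> wp W (Assign x e) Q S A \<tau>"
  unfolding wp_def using exec_Assign[of W "\<lparr>scalar = S, arr = A\<rparr>" e x] by fastforce

lemma wp_Store:
  "fits W \<lparr>scalar = S, arr = A\<rparr> i \<Longrightarrow> fits W \<lparr>scalar = S, arr = A\<rparr> e \<Longrightarrow>
   Q S (A(a := (A a)(val \<lparr>scalar = S, arr = A\<rparr> i := val \<lparr>scalar = S, arr = A\<rparr> e)))
     (\<tau> + (cost i + cost e + 1)) \<Longrightarrow> wp W (Store a i e) Q S A \<tau>"
  unfolding wp_def using exec_Store[of W "\<lparr>scalar = S, arr = A\<rparr>" i e a] by fastforce

lemma wp_Seq: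
  "wp W c1 (wp W c2 Q) S A \<tau> \<Longrightarrow> wp W (Seq c1 c2) Q S A \<tau>"
  unfolding wp_def by (metis exec_Seq add.assoc)

lemma wp_Cond:
  assumes "fits W \<lparr>scalar = S, arr = A\<rparr> e"
    and "val \<lparr>scalar = S, arr = A\<rparr> e \<noteq> 0 \<Longrightarrow> wp W c1 Q S A (\<tau> + (cost e + 1))"
    and "val \<lparr>scalar = S, arr = A\<rparr> e = 0 \<Longrightarrow> wp W c2 Q S A (\<tau> + (cost e + 1))"
  shows "wp W (Cond e c1 c2) Q S A \<tau>"
proof (cases "val \<lparr>scalar = S, arr = A\<rparr> e = 0")
  case True
  with assms show ?thesis unfolding wp_def by (metis exec_CondFalse add.assoc)
next
  case False
  with assms show ?thesis unfolding wp_def by (metis exec_CondTrue add.assoc)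
qed

lemmas wp_intros = wp_Skip wp_Assign wp_Store wp_Seq wp_Cond

definition For :: "vname \<Rightarrow> exp \<Rightarrow> com \<Rightarrow> com" where
  "For i e body = Seq (Assign i (Const 0))
     (While (Op Less (Var i) e) (Seq body (Assign i (Op Add (Var i) (Const 1)))))"

text \<open>\<open>I j\<close> describes the state before the test of round \<open>j\<close>. A test
  takes \<open>cost e + 3\<close> steps and the increment 4, which gives the two clock offsets. The
  expression \<open>e\<close> is evaluated anew in each round, so \<open>bound\<close> has to keep
  its value at \<open>N\<close>.\<close>

lemma wp_For:
  assumes W: "1 < W" "N < W"
    and init: "I 0 (S(i := 0)) A (\<tau> + 2)"
    and step: "\<And>j S A \<tau>. I j S A \<tau> \<Longrightarrow> j < N \<Longrightarrow>
      wp W body (\<lambda>S' A' \<tau>'. S' i = j \<and> I (Suc j) (S'(i := Suc j)) A' (\<tau>' + cost e + 7)) S A \<tau>"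
    and bound: "\<And>j S A \<tau>. I j S A \<tau> \<Longrightarrow> j \<le> N \<Longrightarrow>
      S i = j \<and> fits W \<lparr>scalar = S, arr = A\<rparr> e \<and> val \<lparr>scalar = S, arr = A\<rparr> e = N"
    and final: "\<And>S A \<tau>. I N S A \<tau> \<Longrightarrow> Q S A (\<tau> + cost e + 3)"
  shows "wp W (For i e body) Q S A \<tau>"
proof -
  let ?b = "Op Less (Var i) e" and ?c = "Seq body (Assign i (Op Add (Var i) (Const 1)))"
  have loop: "wp W (While ?b ?c) Q S A \<tau>" if "I j S A \<tau>" "j \<le> N" for j S A \<tau>
    using that
  proof (induction "N - j" arbitrary: j S A \<tau>)
    case 0
    then have "j = N" by simp
    with bound[OF 0(2,3)] W have "fits W \<lparr>scalar = S, arr = A\<rparr> ?b" "val \<lparr>scalar = S, arr = A\<rparr> ?b = 0"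
      by auto
    note exec_WhileFalse[OF this, of ?c]
    moreover have "Q S A (\<tau> + (cost ?b + 1))"
      using final[of S A \<tau>] 0(2) \<open>j = N\<close> by (simp add: add_ac eval_nat_numeral)
    ultimately show ?case unfolding wp_def by blast
  next
    case (Suc k)
    then have j: "j < N" by simp
    with bound[OF Suc(3,4)] W have b: "fits W \<lparr>scalar = S, arr = A\<rparr> ?b" "val \<lparr>scalar = S, arr = A\<rparr> ?b \<noteq> 0"
      by auto
    from step[OF Suc(3) j] obtain t1 S1 A1 where
      e1: "exec W body \<lparr>scalar = S, arr = A\<rparr> t1 \<lparr>scalar = S1, arr = A1\<rparr>" and
      i: "S1 i = j" "I (Suc j) (S1(i := Suc j)) A1 (\<tau> + t1 + cost e + 7)"
      unfolding wp_def by blast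
    have "exec W (Assign i (Op Add (Var i) (Const 1))) \<lparr>scalar = S1, arr = A1\<rparr> 4
        \<lparr>scalar = S1(i := Suc j), arr = A1\<rparr>"
      using exec_Assign[of W "\<lparr>scalar = S1, arr = A1\<rparr>" "Op Add (Var i) (Const 1)" i] i j W
      by (simp add: eval_nat_numeral)
    with e1 have e2: "exec W ?c \<lparr>scalar = S, arr = A\<rparr> (t1 + 4) \<lparr>scalar = S1(i := Suc j), arr = A1\<rparr>"
      by (rule exec_Seq)
    have "k = N - Suc j" using Suc(2) by simp
    from Suc(1)[OF this i(2)] j obtain t2 S2 A2 where
      e3: "exec W (While ?b ?c) \<lparr>scalar = S1(i := Suc j), arr = A1\<rparr> t2 \<lparr>scalar = S2, arr = A2\<rparr>"
      and Q: "Q S2 A2 (\<tau> + t1 + cost e + 7 + t2)"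
      unfolding wp_def by auto
    have "\<tau> + (cost ?b + 1 + (t1 + 4) + t2) = \<tau> + t1 + cost e + 7 + t2" by simp
    with exec_WhileTrue[OF b e2 e3] Q show ?case unfolding wp_def by metis
  qed
  show ?thesis unfolding For_def
    by (rule wp_Seq, rule wp_Assign) (use W loop[OF init] in simp_all)
qed

section \<open>Membership changes of low vertices\<close>

abbreviation seq_com :: "com \<Rightarrow> com \<Rightarrow> com" (infixr ";;" 60) where
  "c1 ;; c2 \<equiv> Seq c1 c2"

abbreviation Cell :: "vname \<Rightarrow> exp \<Rightarrow> exp" where
  "Cell x e \<equiv> Op Add (Op Mul (Var x) (Var ''n'')) e"

text \<open>
  Two-dimensional arrays have rows of length \<open>n\<close>. A cell \<open>(a, b)\<close> of \<open>E\<close> holds 0 if \<open>a\<close> and \<open>b\<close>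
  have never been adjacent, 1 if they were once, and 2 if they are now. Row \<open>a\<close> of \<open>L\<close>, of which
  \<open>len a\<close> cells are in use, lists every vertex that has ever been adjacent to \<open>a\<close>, so deletions
  need not touch it. The array \<open>heavy\<close> is 0 at low vertices and one more than the index in \<open>H\<close> at
  heavy vertices; \<open>c\<close> counts the low neighbours in the held set.
\<close>

definition shift :: "binop \<Rightarrow> com" where
  "shift f = For ''i'' (Get ''len'' (Var ''x''))
     (Assign ''y'' (Get ''L'' (Cell ''x'' (Var ''i''))) ;;
      Cond (Op Less (Const 1) (Get ''E'' (Cell ''x'' (Var ''y''))))
        (Store ''c'' (Var ''y'') (Op f (Get ''c'' (Var ''y'')) (Const 1)))
        Skip)"

text \<open>A sum and a comparison encode a conjunction: a sum is below 1 only if all summands are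
  0. In \<open>enter\<close> the flag is at most 1, so \<open>heavy + c < excluded\<close> holds
  exactly at the low vertices outside the set whose counter is 0.\<close>

definition leave :: com where
  "leave = Cond (Op Less (Op Add (Get ''heavy'' (Var ''x'')) (Get ''excluded'' (Var ''x''))) (Const 1))
     (Store ''excluded'' (Var ''x'') (Const 1) ;; shift Sub) Skip"

definition enter :: com where
  "enter = Cond (Op Less (Op Add (Get ''heavy'' (Var ''x'')) (Get ''c'' (Var ''x'')))
                         (Get ''excluded'' (Var ''x'')))
     (Store ''excluded'' (Var ''x'') (Const 0) ;; shift Add) Skip"

definition lists_ok :: "nat \<Rightarrow> (nat \<Rightarrow> nat) \<Rightarrow> (nat \<Rightarrow> nat) \<Rightarrow> (nat \<Rightarrow> nat) \<Rightarrow> bool" where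
  "lists_ok n E L len \<longleftrightarrow>
     (\<forall>a<n. bij_betw (\<lambda>j. L (a * n + j)) {..<len a} {b. b < n \<and> 0 < E (a * n + b)})"

text \<open>The part of the invariant that membership changes cannot affect, as
  \<open>base_upd\<close> records.\<close>

definition base :: "nat \<Rightarrow> (vname \<Rightarrow> nat \<Rightarrow> nat) \<Rightarrow> bool" where
  "base n A \<longleftrightarrow> lists_ok n (A ''E'') (A ''L'') (A ''len'') \<and>
     (\<forall>a<n. \<forall>b<n. A ''E'' (a * n + b) \<le> 2) \<and> (\<forall>a<n. A ''heavy'' a \<le> n)"

lemma base_upd [simp]:
  "base n (A(''c'' := f)) = base n A"
  "base n (A(''excluded'' := f)) = base n A"
  by (simp_all add: base_def)

text \<open>The vertex \<open>w\<close> may be heavy: the greedy extension learns from the counters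
  of heavy vertices whether a low neighbour blocks them.\<close>

definition count_ok ::
  "nat \<Rightarrow> (nat \<Rightarrow> nat) \<Rightarrow> (nat \<Rightarrow> nat) \<Rightarrow> (nat \<Rightarrow> nat) \<Rightarrow> (nat \<Rightarrow> nat) \<Rightarrow> bool" where
  "count_ok n E hv ex c \<longleftrightarrow>
     (\<forall>w<n. c w = card {x. x < n \<and> hv x = 0 \<and> ex x = 0 \<and> 1 < E (x * n + w)})"

text \<open>Zero counters at low members express independence of the low part. Maximality is kept
  apart, since it fails in the middle of an update.\<close>

definition dyn :: "nat \<Rightarrow> (vname \<Rightarrow> nat \<Rightarrow> nat) \<Rightarrow> bool" where
  "dyn n A \<longleftrightarrow> count_ok n (A ''E'') (A ''heavy'') (A ''excluded'') (A ''c'') \<and>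
     (\<forall>x<n. A ''heavy'' x = 0 \<and> A ''excluded'' x = 0 \<longrightarrow> A ''c'' x = 0) \<and>
     (\<forall>x<n. A ''excluded'' x \<le> 1)"

text \<open>The low vertices at which maximality fails.\<close>

definition suspects :: "nat \<Rightarrow> (vname \<Rightarrow> nat \<Rightarrow> nat) \<Rightarrow> nat set" where
  "suspects n A = {x. x < n \<and> A ''heavy'' x = 0 \<and> A ''excluded'' x \<noteq> 0 \<and> A ''c'' x = 0}"

definition low_out :: "nat \<Rightarrow> (vname \<Rightarrow> nat \<Rightarrow> nat) \<Rightarrow> nat" where
  "low_out n A = card {x. x < n \<and> A ''heavy'' x = 0 \<and> A ''excluded'' x \<noteq> 0}"

section \<open>Row-major cells and neighbour lists\<close>

lemma cell_less: "a < n \<Longrightarrow> b < n \<Longrightarrow> a * n + b < n * (n::nat)"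
proof -
  assume "a < n" "b < n"
  then have "a * n + b < Suc a * n" by simp
  also have "\<dots> \<le> n * n" using \<open>a < n\<close> by (intro mult_right_mono) auto
  finally show ?thesis .
qed

lemma cell_eq_iff:
  assumes "b < n" "d < n"
  shows "a * n + b = c * n + d \<longleftrightarrow> a = c \<and> b = (d::nat)"
proof
  assume *: "a * n + b = c * n + d"
  from assms have "(a * n + b) div n = a" "(c * n + d) div n = c" by simp_all
  with * show "a = c \<and> b = d" by simp
qed simp

lemma lists_ok_length:
  assumes "lists_ok n E L len" "a < n"
  shows "len a \<le> n"
proof -
  have "card {..<len a} = card {b. b < n \<and> 0 < E (a * n + b)}"
    using assms unfolding lists_ok_def by (blast intro: bij_betw_same_card)
  also have "\<dots> \<le> card {..<n}" by (intro card_mono) auto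
  finally show ?thesis by simp
qed

lemma lists_ok_nth:
  assumes "lists_ok n E L len" "a < n" "j < len a"
  shows "L (a * n + j) < n" "0 < E (a * n + L (a * n + j))"
  using assms unfolding lists_ok_def bij_betw_def by blast+

lemma lists_ok_inj:
  assumes "lists_ok n E L len" "a < n" "i < len a" "j < len a" "L (a * n + i) = L (a * n + j)"
  shows "i = j"
  using assms unfolding lists_ok_def bij_betw_def inj_on_def by blast

lemma lists_ok_image:
  assumes "lists_ok n E L len" "a < n"
  shows "(\<lambda>j. L (a * n + j)) ` {..<len a} = {b. b < n \<and> 0 < E (a * n + b)}"
  using assms unfolding lists_ok_def bij_betw_def by blast

lemma count_ok_le: 
  assumes "count_ok n E hv ex c" "w < n"
  shows "c w \<le> n"
proof -
  have "card {x. x < n \<and> hv x = 0 \<and> ex x = 0 \<and> 1 < E (x * n + w)} \<le> card {..<n}"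
    by (intro card_mono) auto
  then have "c w \<le> card {..<n}" using assms unfolding count_ok_def by simp
  then show ?thesis by simp
qed

text \<open>\<open>n * n\<close> covers cell indices and the squared list length in the promotion
  test, \<open>lam * m\<close> the other side of that test. Both bounds hold for
  \<open>W = (n + lam + m + 2) ^ 2\<close>.\<close>

locale word_size =
  fixes W n lam m :: nat
  assumes cells_fit: "n * n + n + 2 < W" and params_fit: "lam * m + lam + m < W"
begin

lemma fits_simps [simp]:
  "a < n \<Longrightarrow> b < n \<Longrightarrow> a * n + b < W" "a < n \<Longrightarrow> b < n \<Longrightarrow> n * a + b < W"
  "a < n \<Longrightarrow> a * n < W" "a < n \<Longrightarrow> n * a < W"
  "a \<le> n \<Longrightarrow> a < W" "a \<le> n \<Longrightarrow> Suc a < W" "a < n \<Longrightarrow> a < W" "0 < W" "1 < W" "Suc 0 < W" "2 < W"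
  "t \<le> m \<Longrightarrow> t < W" "lam < W" "a \<le> 2 \<Longrightarrow> a < W"
proof -
  have *: "a * n < W" if "a < n" for a
    using mult_le_mono1[of a n n] that cells_fit by linarith
  show "a < n \<Longrightarrow> a * n < W" "a < n \<Longrightarrow> n * a < W" using * by (simp_all add: mult.commute)
  show "a < n \<Longrightarrow> b < n \<Longrightarrow> a * n + b < W" "a < n \<Longrightarrow> b < n \<Longrightarrow> n * a + b < W"
    using cells_fit cell_less[of a n b] by (simp_all add: mult.commute)
qed (use cells_fit params_fit in auto)

text \<open>The list of \<open>x\<close> contains every current neighbour once, so each of their
  counters changes exactly once; past neighbours are filtered by the test on \<open>E\<close>. A
  round takes exactly 31 steps: 7 to fetch \<open>y\<close>, 9 for the test, 6 for the store and 9
  for the loop.\<close>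

lemma wp_shift:
  assumes base: "base n A" and x: "S ''n'' = n" "S ''x'' < n" and c: "\<forall>w<n. A ''c'' w \<le> n"
    and f: "f = Add \<or> f = Sub"
    and Q: "\<And>p q \<tau>'. \<tau>' \<le> \<tau> + 7 + 31 * A ''len'' (S ''x'') \<Longrightarrow>
      Q (S(''i'' := p, ''y'' := q))
        (A(''c'' := (\<lambda>w. if w < n \<and> 1 < A ''E'' (S ''x'' * n + w)
                         then binop_val f (A ''c'' w) 1 else A ''c'' w))) \<tau>'"
  shows "wp W (shift f) Q S A \<tau>"
proof -
  define x where "x = S ''x''"
  let ?E = "A ''E''" and ?L = "A ''L''" and ?len = "A ''len''" and ?c = "A ''c''"
  note x = x[folded x_def]
  have l: "lists_ok n ?E ?L ?len" using base by (simp add: base_def)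
  have len: "?len x \<le> n" using lists_ok_length[OF l x(2)] .
  have E2: "?E (x * n + b) \<le> 2" if "b < n" for b using base x that by (simp add: base_def)
  have cW: "binop_val f (?c w) 1 < W" if "w < n" for w
    using f c that cells_fit by (auto simp: less_Suc_eq_le)
  define I where "I = (\<lambda>j S' A' \<tau>'. (\<exists>q. S' = S(''i'' := j, ''y'' := q)) \<and>
      A' = A(''c'' := (\<lambda>w. if w \<in> (\<lambda>i. ?L (x * n + i)) ` {..<j} \<and> 1 < ?E (x * n + w)
                         then binop_val f (?c w) 1 else ?c w)) \<and> \<tau>' \<le> \<tau> + 2 + 31 * j)"
  show ?thesis unfolding shift_def
  proof (rule wp_For[where N = "?len x" and I = I], goal_cases)
    case 1 show ?case by simp
  next
    case 2 show ?case using len by simp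
  next
    case 3
    have "S(''i'' := 0) = S(''i'' := 0, ''y'' := S ''y'')" by auto
    then show ?case unfolding I_def by auto
  next
    case (4 j S' A' \<tau>')
    then obtain q where S': "S' = S(''i'' := j, ''y'' := q)" and t: "\<tau>' \<le> \<tau> + 2 + 31 * j"
      and A': "A' = A(''c'' := (\<lambda>w. if w \<in> (\<lambda>i. ?L (x * n + i)) ` {..<j} \<and> 1 < ?E (x * n + w)
                         then binop_val f (?c w) 1 else ?c w))"
      unfolding I_def by blast
    define y where "y = ?L (x * n + j)"
    have "y < n" using lists_ok_nth[OF l x(2) 4(2)] by (simp add: y_def)
    \<comment> \<open>Lists have no repetitions, so the counter of \<open>y\<close> still has its
      initial value.\<close>
    moreover have "y \<notin> (\<lambda>i. ?L (x * n + i)) ` {..<j}"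
    proof
      assume "y \<in> (\<lambda>i. ?L (x * n + i)) ` {..<j}"
      then obtain i where "i < j" "?L (x * n + j) = ?L (x * n + i)" by (auto simp: y_def)
      with lists_ok_inj[OF l x(2) 4(2), of i] 4(2) show False by simp
    qed
    ultimately have y: "y < n" "y \<notin> (\<lambda>i. ?L (x * n + i)) ` {..<j}" .
    have img: "(\<lambda>i. ?L (x * n + i)) ` {..<Suc j} = insert y ((\<lambda>i. ?L (x * n + i)) ` {..<j})"
      by (auto simp: y_def lessThan_Suc)
    have upd: "S(''i'' := Suc j, ''y'' := y) = S(''i'' := j, ''y'' := y, ''i'' := Suc j)"
      by (auto simp: fun_eq_iff)
    have jn: "j < n" using 4(2) len by simp
    show ?case
      apply (intro wp_intros)
      subgoal using x jn y by (simp add: S' A' x_def[symmetric] y_def[symmetric])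
      subgoal using x jn y E2[OF y(1)] by (simp add: S' A' x_def[symmetric] y_def[symmetric])
      subgoal using x jn y by (simp add: S' A' x_def[symmetric] y_def[symmetric])
      subgoal using x jn y c cW[OF y(1)] by (simp add: S' A' x_def[symmetric] y_def[symmetric])
      subgoal
        using x jn y t unfolding I_def img
        by (auto simp: S' A' x_def[symmetric] y_def[symmetric] upd[symmetric] fun_upd_upd fun_eq_iff
             intro!: exI[of _ y])
      subgoal
        using x jn y t unfolding I_def img
        by (auto simp: S' A' x_def[symmetric] y_def[symmetric] upd[symmetric] fun_eq_iff
             intro!: exI[of _ y])
      done
  next
    case (5 j S' A' \<tau>')
    then show ?case using x len unfolding I_def by (auto simp: x_def[symmetric])
  next
    case (6 S' A' \<tau>')
    then obtain q where S': "S' = S(''i'' := ?len x, ''y'' := q)" and t: "\<tau>' \<le> \<tau> + 2 + 31 * ?len x"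
      and A': "A' = A(''c'' := (\<lambda>w. if w < n \<and> 1 < ?E (x * n + w)
                         then binop_val f (?c w) 1 else ?c w))"
      unfolding I_def lists_ok_image[OF l x(2)] by (auto simp: fun_eq_iff)
    show ?case unfolding S' A' x_def by (rule Q) (use t in \<open>simp add: x_def\<close>)
  qed
qed

end

definition fix_com :: com where
  "fix_com = For ''j'' (Get ''len'' (Var ''a''))
     (Assign ''x'' (Get ''L'' (Cell ''a'' (Var ''j''))) ;; enter)"

definition adj_sym :: "nat \<Rightarrow> (nat \<Rightarrow> nat) \<Rightarrow> bool" where
  "adj_sym n E \<longleftrightarrow> (\<forall>a<n. \<forall>b<n. 1 < E (a * n + b) \<longrightarrow> 1 < E (b * n + a)) \<and>
     (\<forall>a<n. E (a * n + a) = 0)"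

lemma count_ok_leave:
  assumes ok: "count_ok n E hv ex c" and x: "x < n" "hv x = 0" "ex x = 0"
  shows "count_ok n E hv (ex(x := Suc 0)) (\<lambda>w. if w < n \<and> 1 < E (x * n + w) then c w - 1 else c w)"
  unfolding count_ok_def
proof (intro allI impI)
  fix w assume w: "w < n"
  let ?T = "\<lambda>ex. {y. y < n \<and> hv y = 0 \<and> ex y = 0 \<and> 1 < E (y * n + w)}"
  have c: "c w = card (?T ex)" using ok w unfolding count_ok_def by blast
  have T: "?T (ex(x := Suc 0)) = ?T ex - {x}" by auto
  have "finite (?T ex)" by simp
  then show "(if w < n \<and> 1 < E (x * n + w) then c w - 1 else c w) = card (?T (ex(x := Suc 0)))"
    unfolding T c using x w by (auto simp: card_Diff_singleton_if)
qed

lemma count_ok_enter: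
  assumes ok: "count_ok n E hv ex c" and x: "x < n" "hv x = 0" "ex x \<noteq> 0"
  shows "count_ok n E hv (ex(x := 0)) (\<lambda>w. if w < n \<and> 1 < E (x * n + w) then c w + 1 else c w)"
  unfolding count_ok_def
proof (intro allI impI)
  fix w assume w: "w < n"
  let ?T = "\<lambda>ex. {y. y < n \<and> hv y = 0 \<and> ex y = 0 \<and> 1 < E (y * n + w)}"
  have c: "c w = card (?T ex)" using ok w unfolding count_ok_def by blast
  have fin: "finite (?T ex)" by simp
  have nx: "x \<notin> ?T ex" using x by simp
  show "(if w < n \<and> 1 < E (x * n + w) then c w + 1 else c w) = card (?T (ex(x := 0)))"
  proof (cases "1 < E (x * n + w)")
    case True
    then have "?T (ex(x := 0)) = insert x (?T ex)" using x by auto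
    then show ?thesis using True w c nx fin by simp
  next
    case False
    then have "?T (ex(x := 0)) = ?T ex" using x by auto
    then show ?thesis using False c by simp
  qed
qed

context word_size
begin

lemma dyn_fits:
  assumes "dyn n A" "base n A" "x < n"
  shows "A ''c'' x \<le> n" "A ''heavy'' x \<le> n" "A ''excluded'' x \<le> 1" "A ''len'' x \<le> n"
  using assms count_ok_le lists_ok_length unfolding dyn_def base_def by blast+

text \<open>Only neighbours of \<open>x\<close> can lose a member next to them, so maximality can
  newly fail only there and at \<open>x\<close>. At a heavy \<open>x\<close> nothing is done,
  because no counter takes it into account.\<close>

lemma wp_leave:
  assumes base: "base n A" and dyn: "dyn n A" and x: "S ''n'' = n" "S ''x'' < n"
    and Q: "\<And>p q c A' x \<tau>'. x = S ''x'' \<Longrightarrow>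
        A' = A(''excluded'' := (if A ''heavy'' x = 0 then (A ''excluded'')(x := 1) else A ''excluded''), ''c'' := c) \<Longrightarrow>
        dyn n A' \<Longrightarrow>
        suspects n A' \<subseteq> suspects n A \<union> {w. A ''heavy'' x = 0 \<and> (w = x \<or> w < n \<and> 1 < A ''E'' (x * n + w))} \<Longrightarrow>
        low_out n A' \<le> low_out n A + 1 \<Longrightarrow>
        \<tau>' \<le> \<tau> + 20 + (if A ''heavy'' x = 0 then 31 * A ''len'' x else 0) \<Longrightarrow>
        Q (S(''i'' := p, ''y'' := q)) A' \<tau>'"
  shows "wp W leave Q S A \<tau>"
proof -
  define x where "x = S ''x''"
  let ?ex = "A ''excluded''"
  note x = x[folded x_def]
  note b = dyn_fits[OF dyn base x(2)]
  have bw: "\<forall>w<n. A ''c'' w \<le> n" using dyn_fits[OF dyn base] by blast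
  have low_out: "low_out n (A(''excluded'' := ?ex(x := Suc 0), ''c'' := c)) \<le> low_out n A + 1" for c
  proof -
    have "{y. y < n \<and> A ''heavy'' y = 0 \<and> (?ex(x := Suc 0)) y \<noteq> 0}
       \<subseteq> insert x {y. y < n \<and> A ''heavy'' y = 0 \<and> ?ex y \<noteq> 0}" (is "?T' \<subseteq> insert x ?T")
      by auto
    then have "card ?T' \<le> card (insert x ?T)" by (intro card_mono) auto
    also have "\<dots> \<le> card ?T + 1" by (simp add: card_insert_if)
    finally show ?thesis by (simp add: low_out_def)
  qed
  have fits1: "A ''heavy'' x + ?ex x < W" using b cells_fit by linarith
  note Q' = Q[OF x_def refl]
  show ?thesis
  proof (cases "A ''heavy'' x = 0 \<and> ?ex x = 0")
    case False
    have ex: "(if A ''heavy'' x = 0 then ?ex(x := 1) else ?ex) = ?ex"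
      using b(3) False by (auto simp: fun_eq_iff)
    have *: "Q S A \<tau>'" if "\<tau>' \<le> \<tau> + 20" for \<tau>'
      using Q'[of "A ''c''" \<tau>' "S ''i''" "S ''y''", unfolded ex fun_upd_triv] dyn that by auto
    show ?thesis unfolding leave_def
      apply (intro wp_intros)
      using False b x fits1 by (auto simp: x_def[symmetric] intro!: *)
  next
    case True
    define c' where "c' = (\<lambda>w. if w < n \<and> 1 < A ''E'' (x * n + w) then A ''c'' w - 1 else A ''c'' w)"
    let ?A' = "A(''excluded'' := ?ex(x := Suc 0), ''c'' := c')"
    have dyn': "dyn n ?A'"
      using dyn count_ok_leave[of n "A ''E''" "A ''heavy''" ?ex "A ''c''" x, folded c'_def] True x
      unfolding dyn_def by (auto simp: c'_def)
    have sus: "suspects n ?A' \<subseteq> suspects n A \<union> {w. A ''heavy'' x = 0 \<and> (w = x \<or> w < n \<and> 1 < A ''E'' (x * n + w))}"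
      using True by (auto simp: suspects_def c'_def split: if_splits)
    have *: "Q (S(''i'' := p, ''y'' := q)) A' \<tau>'" if "A' = ?A'" "\<tau>' \<le> \<tau> + 20 + 31 * A ''len'' x" for A' p q \<tau>'
      using Q'[of c'] True sus dyn' low_out[of c'] that by simp
    show ?thesis unfolding leave_def
      apply (intro wp_intros)
      subgoal using b x fits1 by (simp add: x_def[symmetric])
      subgoal using x by (simp add: x_def[symmetric])
      subgoal by simp
      subgoal
        apply (rule wp_shift)
            apply (use base x bw in \<open>simp_all add: x_def[symmetric]\<close>)
        by (rule *) (auto simp: c'_def fun_eq_iff)
      subgoal using True by (simp add: x_def[symmetric])
      done
  qed
qed

text \<open>Entering raises counters and so creates no new suspects. The potential
  \<open>low_out\<close>, at \<open>31 * D + 20\<close> steps per vertex, falls by one exactly when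
  the list of \<open>x\<close> is scanned; an amortized constant 20 remains.\<close>

lemma wp_enter:
  assumes base: "base n A" and dyn: "dyn n A" and sym: "adj_sym n (A ''E'')"
    and x: "S ''n'' = n" "S ''x'' < n" and D: "\<forall>x<n. A ''heavy'' x = 0 \<longrightarrow> A ''len'' x \<le> D"
    and Q: "\<And>p q ex c A' \<tau>'. A' = A(''excluded'' := ex, ''c'' := c) \<Longrightarrow>
        dyn n A' \<Longrightarrow> suspects n A' \<subseteq> suspects n A - {S ''x''} \<Longrightarrow>
        \<tau>' + low_out n A' * (31 * D + 20) \<le> \<tau> + 20 + low_out n A * (31 * D + 20) \<Longrightarrow>
        Q (S(''i'' := p, ''y'' := q)) A' \<tau>'"
  shows "wp W enter Q S A \<tau>"
proof -
  define x where "x = S ''x''"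
  let ?ex = "A ''excluded''" and ?E = "A ''E''" and ?hv = "A ''heavy''" and ?c = "A ''c''"
  note x = x[folded x_def]
  note b = dyn_fits[OF dyn base x(2)]
  have bw: "\<forall>w<n. A ''c'' w \<le> n" using dyn_fits[OF dyn base] by blast
  note Q' = Q[OF refl, folded x_def]
  have ok: "count_ok n ?E ?hv ?ex ?c" and ind: "\<And>y. y < n \<Longrightarrow> ?hv y = 0 \<Longrightarrow> ?ex y = 0 \<Longrightarrow> ?c y = 0"
    using dyn by (auto simp: dyn_def)
  have fits1: "?hv x + ?c x < W"
  proof (cases "?hv x = 0")
    case False
    have "n * n + n + 2 < W" by (rule cells_fit)
    moreover have "n \<le> n * n" by simp
    ultimately show ?thesis using b by linarith
  qed (use b in simp)
  show ?thesis
  proof (cases "?hv x = 0 \<and> ?ex x \<noteq> 0 \<and> ?c x = 0")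
    case False
    then have sus: "x \<notin> suspects n A" by (auto simp: suspects_def)
    have nt: "\<not> ?hv x + ?c x < ?ex x" using False b(3) by auto
    have *: "Q S A \<tau>'" if "\<tau>' \<le> \<tau> + 20" for \<tau>'
      using Q'[of ?ex ?c \<tau>' "S ''i''" "S ''y''", unfolded fun_upd_triv] dyn that sus by auto
    show ?thesis unfolding enter_def
      apply (intro wp_intros)
      using nt b x fits1 by (auto simp: x_def[symmetric] intro!: *)
  next
    case True
    define c' where "c' = (\<lambda>w. if w < n \<and> 1 < ?E (x * n + w) then ?c w + 1 else ?c w)"
    let ?A' = "A(''excluded'' := ?ex(x := 0), ''c'' := c')"
    \<comment> \<open>The counter of \<open>x\<close> speaks about the column of \<open>x\<close>,
      the scan about its row. Symmetry carries the information over: no low member has its counter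
      raised.\<close>
    have nbr: "\<not> 1 < ?E (x * n + y)" if y: "y < n" "?hv y = 0" "?ex y = 0" for y
    proof
      assume "1 < ?E (x * n + y)"
      then have "1 < ?E (y * n + x)" using sym x y by (simp add: adj_sym_def)
      with y have "y \<in> {y. y < n \<and> ?hv y = 0 \<and> ?ex y = 0 \<and> 1 < ?E (y * n + x)}" (is "_ \<in> ?T") by simp
      moreover have "card ?T = 0" using ok True x unfolding count_ok_def by auto
      then have "?T = {}" by simp
      ultimately show False by blast
    qed
    \<comment> \<open>The counter of \<open>x\<close> itself must stay 0 as well, as
      \<open>x\<close> is now a member.\<close>
    have irr: "?E (x * n + x) = 0" using sym x by (simp add: adj_sym_def)
    have dyn': "dyn n ?A'"
      using dyn count_ok_enter[OF ok x(2), folded c'_def] True x ind nbr irr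
      unfolding dyn_def by (auto simp: c'_def)
    have sus: "suspects n ?A' \<subseteq> suspects n A - {x}"
      using True by (auto simp: suspects_def c'_def split: if_splits)
    have lo: "low_out n A = Suc (low_out n ?A')"
    proof -
      let ?T = "{y. y < n \<and> ?hv y = 0 \<and> ?ex y \<noteq> 0}"
      have "{y. y < n \<and> ?hv y = 0 \<and> (?ex(x := 0)) y \<noteq> 0} = ?T - {x}" by auto
      moreover have "x \<in> ?T" using True x by simp
      then have "card ?T = Suc (card (?T - {x}))" by (intro card.remove) auto
      ultimately show ?thesis by (simp add: low_out_def)
    qed
    have "A ''len'' x \<le> D" using D True x by simp
    then have *: "Q (S(''i'' := p, ''y'' := q)) A' \<tau>'" if "A' = ?A'" "\<tau>' \<le> \<tau> + 20 + 31 * A ''len'' x" for A' \<tau>' p q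
      using Q'[of "?ex(x := 0)" c' \<tau>'] True sus dyn' that by (simp add: lo)
    show ?thesis unfolding enter_def
      apply (intro wp_intros)
      subgoal using b x fits1 by (simp add: x_def[symmetric])
      subgoal using x by (simp add: x_def[symmetric])
      subgoal by simp
      subgoal
        apply (rule wp_shift)
            apply (use base x bw in \<open>simp_all add: x_def[symmetric]\<close>)
        by (rule *) (auto simp: c'_def fun_eq_iff)
      subgoal using True by (simp add: x_def[symmetric])
      done
  qed
qed

text \<open>Suspects only shrink, so a vertex once treated needs no second visit and the order is
  irrelevant. Past neighbours on the list do no harm, because \<open>enter\<close> acts only where
  maximality fails.\<close>

lemma wp_fix:
  assumes base: "base n A" and dyn: "dyn n A" and sym: "adj_sym n (A ''E'')"
    and a: "S ''n'' = n" "S ''a'' < n" and D: "\<forall>x<n. A ''heavy'' x = 0 \<longrightarrow> A ''len'' x \<le> D"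
    and Q: "\<And>p q r s ex c A' \<tau>'. A' = A(''excluded'' := ex, ''c'' := c) \<Longrightarrow>
        dyn n A' \<Longrightarrow> suspects n A' \<subseteq> suspects n A - {b. b < n \<and> 0 < A ''E'' (S ''a'' * n + b)} \<Longrightarrow>
        \<tau>' + low_out n A' * (31 * D + 20) \<le> \<tau> + 7 + 40 * A ''len'' (S ''a'') + low_out n A * (31 * D + 20) \<Longrightarrow>
        Q (S(''j'' := p, ''x'' := q, ''i'' := r, ''y'' := s)) A' \<tau>'"
  shows "wp W fix_com Q S A \<tau>"
proof -
  define a where "a = S ''a''"
  let ?L = "A ''L''" and ?len = "A ''len''"
  note a = a[folded a_def]
  have l: "lists_ok n (A ''E'') ?L ?len" using base by (simp add: base_def)
  have len: "?len a \<le> n" using lists_ok_length[OF l a(2)] .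
  note Q' = Q[OF refl, folded a_def]
  define I where "I = (\<lambda>j S' A' \<tau>'. (\<exists>q r s. S' = S(''j'' := j, ''x'' := q, ''i'' := r, ''y'' := s)) \<and>
      (\<exists>ex c. A' = A(''excluded'' := ex, ''c'' := c)) \<and> dyn n A' \<and>
      suspects n A' \<subseteq> suspects n A - (\<lambda>i. ?L (a * n + i)) ` {..<j} \<and>
      \<tau>' + low_out n A' * (31 * D + 20) \<le> \<tau> + 2 + 40 * j + low_out n A * (31 * D + 20))"
  show ?thesis unfolding fix_com_def
  proof (rule wp_For[where N = "?len a" and I = I], goal_cases)
    case 1 show ?case by simp
  next
    case 2 show ?case using len by simp
  next
    case 3
    have "S(''j'' := 0) = S(''j'' := 0, ''x'' := S ''x'', ''i'' := S ''i'', ''y'' := S ''y'')"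
      by (auto simp: fun_eq_iff)
    moreover have "A = A(''excluded'' := A ''excluded'', ''c'' := A ''c'')" by simp
    ultimately show ?case unfolding I_def using dyn by (simp; metis)
  next
    case (4 j S' A' \<tau>')
    then obtain q r s ex c where S': "S' = S(''j'' := j, ''x'' := q, ''i'' := r, ''y'' := s)"
      and A': "A' = A(''excluded'' := ex, ''c'' := c)" and dyn': "dyn n A'"
      and sus: "suspects n A' \<subseteq> suspects n A - (\<lambda>i. ?L (a * n + i)) ` {..<j}"
      and t: "\<tau>' + low_out n A' * (31 * D + 20) \<le> \<tau> + 2 + 40 * j + low_out n A * (31 * D + 20)"
      unfolding I_def by blast
    define x where "x = ?L (a * n + j)"
    have x: "x < n" using lists_ok_nth[OF l a(2) 4(2)] by (simp add: x_def)
    have img: "(\<lambda>i. ?L (a * n + i)) ` {..<Suc j} = insert x ((\<lambda>i. ?L (a * n + i)) ` {..<j})"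
      by (auto simp: x_def lessThan_Suc)
    have jn: "j < n" using 4(2) len by simp
    let ?S = "S(''j'' := j, ''i'' := r, ''y'' := s, ''x'' := x)"
    have S2: "S'(''x'' := x) = ?S" unfolding S' by (auto simp: fun_eq_iff)
    have I': "I (Suc j) (?S(''i'' := p, ''y'' := q, ''j'' := Suc j)) (A'(''excluded'' := ex', ''c'' := c')) (9 + \<tau>'')"
      if "dyn n (A'(''excluded'' := ex', ''c'' := c'))"
        "suspects n (A'(''excluded'' := ex', ''c'' := c')) \<subseteq> suspects n A' - {x}"
        "\<tau>'' + low_out n (A'(''excluded'' := ex', ''c'' := c')) * (31 * D + 20)
           \<le> 27 + \<tau>' + low_out n A' * (31 * D + 20)" for ex' c' p q \<tau>''
    proof -
      have "?S(''i'' := p, ''y'' := q, ''j'' := Suc j) = S(''j'' := Suc j, ''x'' := x, ''i'' := p, ''y'' := q)"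
        by (auto simp: fun_eq_iff)
      moreover have "A'(''excluded'' := ex', ''c'' := c') = A(''excluded'' := ex', ''c'' := c')"
        unfolding A' by (auto simp: fun_eq_iff)
      moreover have "9 + \<tau>'' + low_out n (A'(''excluded'' := ex', ''c'' := c')) * (31 * D + 20)
          \<le> \<tau> + 2 + 40 * Suc j + low_out n A * (31 * D + 20)"
        using that(3) t by simp
      ultimately show ?thesis unfolding I_def img using that(1,2) sus by (auto 0 3)
    qed
    have E': "A' ''E'' = A ''E''" "A' ''heavy'' = A ''heavy''" "A' ''len'' = A ''len''" "A' ''L'' = A ''L''"
      unfolding A' by simp_all
    have base': "base n A'" using base unfolding A' by simp
    show ?case
      apply (intro wp_intros)
      subgoal using a jn x by (simp add: S' E' x_def[symmetric] a_def[symmetric])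
      subgoal
        apply (rule wp_enter[OF base' dyn', where D = D])
            apply (use sym a x D in \<open>simp_all add: E' S' a_def[symmetric] x_def[symmetric] Let_def\<close>)
        using I' by (simp add: S2[unfolded S'])
      done
  next
    case (5 j S' A' \<tau>')
    then show ?case using a len unfolding I_def by (auto simp: a_def[symmetric])
  next
    case (6 S' A' \<tau>')
    then show ?case
      unfolding I_def lists_ok_image[OF l a(2)] by (auto intro!: Q')
  qed
qed

end

section \<open>Edge changes and heavy vertices\<close>

text \<open>\<open>insert + 1\<close> is the code of the cell, 2 after an insertion and 1 after a
  deletion. The list grows only when two vertices meet for the first time.\<close>

definition link :: com where
  "link =
     Cond (Get ''E'' (Cell ''a'' (Var ''b''))) Skip
       (Store ''L'' (Cell ''a'' (Get ''len'' (Var ''a''))) (Var ''b'') ;;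
        Store ''len'' (Var ''a'') (Op Add (Get ''len'' (Var ''a'')) (Const 1))) ;;
     Store ''E'' (Cell ''a'' (Var ''b'')) (Op Add (Var ''insert'') (Const 1))"

text \<open>The inner comparison yields 0 or 1, so the outer one demands both that \<open>a\<close>
  is low and that the inner one is true. Squaring avoids a square root.\<close>

definition promote :: com where
  "promote =
     Cond (Op Less (Get ''heavy'' (Var ''a''))
             (Op Less (Op Mul (Var ''lambda'') (Var ''t''))
                (Op Mul (Get ''len'' (Var ''a'')) (Get ''len'' (Var ''a'')))))
       (Store ''H'' (Var ''hn'') (Var ''a'') ;;
        Assign ''hn'' (Op Add (Var ''hn'') (Const 1)) ;;
        Store ''heavy'' (Var ''a'') (Var ''hn''))
       Skip"

text \<open>The row of a heavy vertex in \<open>row\<close> lists only those heavy neighbours that precede it in \<open>H\<close>,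
  which is all that the greedy extension in the order of \<open>H\<close> has to consult.\<close>

definition scan_row :: com where
  "scan_row =
     Assign ''k'' (Const 0) ;;
     For ''i'' (Op Sub (Get ''heavy'' (Var ''a'')) (Const 1))
       (Assign ''y'' (Get ''H'' (Var ''i'')) ;;
        Cond (Op Less (Const 1) (Get ''E'' (Cell ''a'' (Var ''y''))))
          (Store ''row'' (Cell ''a'' (Var ''k'')) (Var ''y'') ;;
           Assign ''k'' (Op Add (Var ''k'') (Const 1)))
          Skip) ;;
     Store ''rlen'' (Var ''a'') (Var ''k'')"

definition check_row :: com where
  "check_row = For ''j'' (Get ''rlen'' (Var ''x''))
     (Cond (Get ''excluded'' (Get ''row'' (Cell ''x'' (Var ''j'')))) Skip (Assign ''k'' (Const 1)))"

definition greedy :: com where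
  "greedy = For ''i'' (Var ''hn'')
     (Assign ''x'' (Get ''H'' (Var ''i'')) ;;
      Assign ''k'' (Op Less (Const 0) (Get ''c'' (Var ''x''))) ;;
      check_row ;;
      Store ''excluded'' (Var ''x'') (Var ''k''))"

section \<open>Invariants of lists, heavy vertices and rows\<close>

definition heavies_ok :: "nat \<Rightarrow> (nat \<Rightarrow> nat) \<Rightarrow> (nat \<Rightarrow> nat) \<Rightarrow> nat \<Rightarrow> bool" where
  "heavies_ok n hv H hn \<longleftrightarrow> (\<forall>i<hn. H i < n \<and> hv (H i) = Suc i) \<and>
     (\<forall>v<n. 0 < hv v \<longrightarrow> hv v \<le> hn \<and> H (hv v - 1) = v)"

text \<open>\<open>Z\<close> exempts the vertices whose rows are out of date in the middle of an
  update.\<close>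

definition rows_ok ::
  "nat \<Rightarrow> (nat \<Rightarrow> nat) \<Rightarrow> (nat \<Rightarrow> nat) \<Rightarrow> nat \<Rightarrow> (nat \<Rightarrow> nat) \<Rightarrow> (nat \<Rightarrow> nat) \<Rightarrow> nat set \<Rightarrow> bool" where
  "rows_ok n E H hn row rlen Z \<longleftrightarrow>
     (\<forall>i<hn. H i \<notin> Z \<longrightarrow> map (\<lambda>j. row (H i * n + j)) [0..<rlen (H i)] =
                          filter (\<lambda>y. 1 < E (H i * n + y)) (map H [0..<i]))"

text \<open>As \<open>a\<close> never occurs in its own list, fewer than \<open>n\<close> cells are
  in use before the insertion, and the new entry stays within row \<open>a\<close>.\<close>

lemma lists_ok_insert:
  assumes ok: "lists_ok n E L len" and a: "a < n" "b < n" "a \<noteq> b" "E (a * n + a) = 0"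
    and E: "E (a * n + b) = 0" and d: "0 < d"
  shows "lists_ok n (E(a * n + b := d)) (L(a * n + len a := b)) (len(a := Suc (len a)))" "len a < n"
proof -
  let ?B = "\<lambda>E x. {y. y < n \<and> 0 < E (x * n + y)}"
  have "card {..<len a} = card (?B E a)"
    using ok a unfolding lists_ok_def by (blast intro: bij_betw_same_card)
  also have "\<dots> \<le> card ({..<n} - {a})" using a by (intro card_mono) auto
  also have "\<dots> = n - 1" using a by simp
  finally show len: "len a < n" using a by simp
  show "lists_ok n (E(a * n + b := d)) (L(a * n + len a := b)) (len(a := Suc (len a)))"
    unfolding lists_ok_def
  proof (intro allI impI)
    fix x assume x: "x < n"
    let ?L = "L(a * n + len a := b)" and ?E = "E(a * n + b := d)"
    have bij: "bij_betw (\<lambda>j. L (x * n + j)) {..<len x} (?B E x)"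
      using ok x unfolding lists_ok_def by blast
    have "L (x * n + j) = ?L (x * n + j)" if "j < len x" for j
      using that lists_ok_length[OF ok x] len by (auto simp: cell_eq_iff)
    then have bij': "bij_betw (\<lambda>j. ?L (x * n + j)) {..<len x} (?B E x)"
      using bij_betw_cong[of "{..<len x}" "\<lambda>j. L (x * n + j)" "\<lambda>j. ?L (x * n + j)"] bij by auto
    show "bij_betw (\<lambda>j. ?L (x * n + j)) {..<(len(a := Suc (len a))) x} (?B ?E x)"
    proof (cases "x = a")
      case True
      have "bij_betw (\<lambda>j. ?L (a * n + j)) ({..<len a} \<union> {len a}) (?B E a \<union> {?L (a * n + len a)})"
        by (rule notIn_Un_bij_betw) (use bij' True E in auto)
      moreover have "?B E a \<union> {?L (a * n + len a)} = ?B ?E a"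
        using a d by (auto simp: cell_eq_iff)
      moreover have "{..<len a} \<union> {len a} = {..<Suc (len a)}" by auto
      ultimately show ?thesis using True by simp
    next
      case False
      then have "?B E x = ?B ?E x" using a by (auto simp: cell_eq_iff)
      with bij' False show ?thesis by simp
    qed
  qed
qed

lemma lists_ok_update:
  assumes ok: "lists_ok n E L len" and a: "a < n" "b < n" and E: "0 < E (a * n + b)" and d: "0 < d"
  shows "lists_ok n (E(a * n + b := d)) L len"
proof -
  have "{y. y < n \<and> 0 < (E(a * n + b := d)) (x * n + y)} = {y. y < n \<and> 0 < E (x * n + y)}" for x
    using E d by auto
  with ok show ?thesis unfolding lists_ok_def by simp
qed

lemma heavies_ok_le:
  assumes "heavies_ok n hv H hn"
  shows "hn \<le> n"
proof -
  have "inj_on H {..<hn}"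
    using assms unfolding heavies_ok_def inj_on_def by (metis lessThan_iff nat.inject)
  moreover have "H ` {..<hn} \<subseteq> {..<n}" using assms unfolding heavies_ok_def by auto
  ultimately have "card {..<hn} \<le> card {..<n}" by (metis card_inj_on_le finite_lessThan)
  then show ?thesis by simp
qed

lemma heavies_ok_promote:
  assumes "heavies_ok n hv H hn" "a < n" "hv a = 0"
  shows "heavies_ok n (hv(a := Suc hn)) (H(hn := a)) (Suc hn)"
  using assms unfolding heavies_ok_def by (auto simp: less_Suc_eq le_Suc_eq) 

section \<open>Correctness and cost of the programs for edges and heavy vertices\<close>

context word_size
begin

lemma wp_link:
  assumes base: "base n A" and a: "S ''n'' = n" "S ''a'' < n" "S ''b'' < n" "S ''a'' \<noteq> S ''b''"
    and irr: "A ''E'' (S ''a'' * n + S ''a'') = 0" and ins: "S ''insert'' \<le> 1"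
    and Q: "\<And>L' len' A' \<tau>'. A' = A(''L'' := L', ''len'' := len',
           ''E'' := (A ''E'')(S ''a'' * n + S ''b'' := Suc (S ''insert''))) \<Longrightarrow> base n A' \<Longrightarrow>
       (\<And>y. y \<noteq> S ''a'' \<Longrightarrow> len' y = A ''len'' y) \<Longrightarrow> len' (S ''a'') \<le> A ''len'' (S ''a'') + 1 \<Longrightarrow>
       \<tau>' \<le> \<tau> + 40 \<Longrightarrow> Q S A' \<tau>'"
  shows "wp W link Q S A \<tau>"
proof -
  define x y where "x = S ''a''" "y = S ''b''"
  note xy = x_y_def[symmetric]
  note a = a[unfolded xy] and irr = irr[unfolded xy]
  let ?E = "A ''E''" and ?L = "A ''L''" and ?len = "A ''len''"
  have ok: "lists_ok n ?E ?L ?len" using base by (simp add: base_def)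
  have len: "?len x \<le> n" using lists_ok_length[OF ok a(2)] .
  have E2: "?E (x * n + y) \<le> 2" using base a by (simp add: base_def)
  have base_E: "base n (A(''L'' := L', ''len'' := len', ''E'' := ?E(x * n + y := Suc (S ''insert''))))"
    if "lists_ok n (?E(x * n + y := Suc (S ''insert''))) L' len'" for L' len'
    using base that ins by (simp add: base_def)
  note Q' = Q[OF refl, unfolded xy]
  show ?thesis
  proof (cases "?E (x * n + y) = 0")
    case True
    note ins_ok = lists_ok_insert[OF ok a(2-4) irr True, of "Suc (S ''insert'')"]
    have *: "Q S A' \<tau>'" if "A' = A(''L'' := ?L(x * n + ?len x := y), ''len'' := ?len(x := Suc (?len x)),
        ''E'' := ?E(x * n + y := Suc (S ''insert'')))" "\<tau>' \<le> \<tau> + 40" for A' \<tau>'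
      unfolding that(1) by (rule Q') (use base_E ins_ok that(2) in simp_all)
    have "?len x < n" using ins_ok(2) by simp
    with a len ins True show ?thesis unfolding link_def
      apply (intro wp_intros)
             apply (simp_all add: xy)
      apply (rule *)
       apply (auto simp: fun_eq_iff)
      done
  next
    case False
    have *: "Q S A' \<tau>'" if "A' = A(''E'' := ?E(x * n + y := Suc (S ''insert'')))" "\<tau>' \<le> \<tau> + 40" for A' \<tau>'
    proof -
      have A': "A' = A(''L'' := ?L, ''len'' := ?len, ''E'' := ?E(x * n + y := Suc (S ''insert'')))"
        using that(1) by simp
      show ?thesis unfolding A'
        by (rule Q') (use base_E[OF lists_ok_update[OF ok a(2,3)]] False that(2) in simp_all)
    qed
    with a len ins False E2 show ?thesis unfolding link_def
      by (intro wp_intros) (simp_all add: xy)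
  qed
qed

lemma wp_promote:
  assumes base: "base n A" and hv: "heavies_ok n (A ''heavy'') (A ''H'') (S ''hn'')"
    and a: "S ''n'' = n" "S ''a'' < n" and lam: "S ''lambda'' = lam" and t: "S ''t'' \<le> m"
    and yes: "\<And>\<tau>'. A ''heavy'' (S ''a'') = 0 \<Longrightarrow> lam * S ''t'' < (A ''len'' (S ''a''))\<^sup>2 \<Longrightarrow>
      \<tau>' \<le> \<tau> + 30 \<Longrightarrow>
      Q (S(''hn'' := Suc (S ''hn''))) (A(''H'' := (A ''H'')(S ''hn'' := S ''a''),
        ''heavy'' := (A ''heavy'')(S ''a'' := Suc (S ''hn'')))) \<tau>'"
    and no: "\<And>\<tau>'. 0 < A ''heavy'' (S ''a'') \<or> (A ''len'' (S ''a''))\<^sup>2 \<le> lam * S ''t'' \<Longrightarrow>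
      \<tau>' \<le> \<tau> + 30 \<Longrightarrow> Q S A \<tau>'"
  shows "wp W promote Q S A \<tau>"
proof -
  define x where "x = S ''a''"
  note x_def[symmetric, simp]
  have ok: "lists_ok n (A ''E'') (A ''L'') (A ''len'')" using base by (simp add: base_def)
  have len: "A ''len'' x \<le> n" using lists_ok_length[OF ok] a by simp
  have sq: "A ''len'' x * A ''len'' x < W"
    using mult_le_mono[OF len len] cells_fit by linarith
  have lt: "lam * S ''t'' < W"
    using mult_le_mono2[OF t, of lam] params_fit by linarith
  have hx: "A ''heavy'' x \<le> n" using base a by (simp add: base_def)
  have hn: "S ''hn'' \<le> n" using heavies_ok_le[OF hv] .
  have tW: "S ''t'' < W" using t by simp
  show ?thesis unfolding promote_def
    apply (intro wp_intros)
    subgoal using a lam len sq lt hx tW by simp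
    subgoal using hn by simp
    subgoal using a by simp
    subgoal using hn by simp
    subgoal using a by simp
    subgoal using hn by simp
    subgoal using yes lam by (simp add: power2_eq_square split: if_splits)
    subgoal using no lam by (auto simp: power2_eq_square split: if_splits)
    done
qed

text \<open>At a low \<open>a\<close> the truncated \<open>heavy a - 1\<close> is 0, so an empty row
  is written. This is harmless, since \<open>rows_ok\<close> looks only at vertices in
  \<open>H\<close>; hence the program needs no case distinction.\<close>

lemma wp_scan_row:
  assumes base: "base n A" and hv: "heavies_ok n (A ''heavy'') (A ''H'') (S ''hn'')"
    and a: "S ''n'' = n" "S ''a'' < n"
    and Q: "\<And>p q r row rlen \<tau>'.
      (\<And>x j. x \<noteq> S ''a'' \<Longrightarrow> j < n \<Longrightarrow> row (x * n + j) = A ''row'' (x * n + j)) \<Longrightarrow>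
      (\<And>x. x \<noteq> S ''a'' \<Longrightarrow> rlen x = A ''rlen'' x) \<Longrightarrow>
      map (\<lambda>j. row (S ''a'' * n + j)) [0..<rlen (S ''a'')] =
        filter (\<lambda>y. 1 < A ''E'' (S ''a'' * n + y)) (map (A ''H'') [0..<A ''heavy'' (S ''a'') - 1]) \<Longrightarrow>
      \<tau>' \<le> \<tau> + 15 + 50 * S ''hn'' \<Longrightarrow>
      Q (S(''k'' := p, ''i'' := q, ''y'' := r)) (A(''row'' := row, ''rlen'' := rlen)) \<tau>'"
  shows "wp W scan_row Q S A \<tau>"
proof -
  define a where "a = S ''a''"
  let ?H = "A ''H''" and ?E = "A ''E''" and ?h = "A ''heavy'' (S ''a'') - 1"
  note a_def[symmetric, simp]
  note a = a[simplified] and Q' = Q[simplified]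
  define P where "P = (\<lambda>y. 1 < ?E (a * n + y))"
  have hn: "S ''hn'' \<le> n" using heavies_ok_le[OF hv] .
  have h: "?h \<le> S ''hn''" "?h \<le> n" "A ''heavy'' a \<le> n" 
    using hv a hn unfolding heavies_ok_def by fastforce+
  have H: "?H j < n" if "j < ?h" for j using hv that h(1) unfolding heavies_ok_def by auto
  have h': "?h < n \<or> ?h = 0" using h(3) by auto
  have E2: "?E (a * n + y) \<le> 2" if "y < n" for y using base a that by (simp add: base_def)
  define I where "I = (\<lambda>j S' A' \<tau>'. (\<exists>k r row. S' = S(''k'' := k, ''i'' := j, ''y'' := r) \<and>
      A' = A(''row'' := row) \<and> (\<forall>x j. x \<noteq> a \<longrightarrow> j < n \<longrightarrow> row (x * n + j) = A ''row'' (x * n + j)) \<and>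
      map (\<lambda>j. row (a * n + j)) [0..<k] = filter P (map ?H [0..<j])) \<and> \<tau>' \<le> \<tau> + 4 + 50 * j)"
  show ?thesis unfolding scan_row_def
  proof (intro wp_intros, simp, rule wp_For[where N = ?h and I = I], goal_cases)
    case 1 show ?case by simp
  next
    case 2 show ?case using h by simp
  next
    case 3
    have "S(''k'' := 0, ''i'' := 0) = S(''k'' := 0, ''i'' := 0, ''y'' := S ''y'')"
      by (auto simp: fun_eq_iff)
    then show ?case unfolding I_def by (auto intro!: exI[of _ "A ''row''"])
  next
    case (4 j S' A' \<tau>')
    then obtain k r row where S': "S' = S(''k'' := k, ''i'' := j, ''y'' := r)" and A': "A' = A(''row'' := row)"
      and fr: "\<And>x j. x \<noteq> a \<Longrightarrow> j < n \<Longrightarrow> row (x * n + j) = A ''row'' (x * n + j)"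
      and row: "map (\<lambda>j. row (a * n + j)) [0..<k] = filter P (map ?H [0..<j])" and t: "\<tau>' \<le> \<tau> + 4 + 50 * j"
      unfolding I_def by blast
    define y where "y = ?H j"
    note y_def[symmetric, simp]
    have y: "y < n" using H[OF 4(2)] by simp
    have "length (map (\<lambda>j. row (a * n + j)) [0..<k]) \<le> length (map ?H [0..<j])"
      unfolding row by (rule length_filter_le)
    then have k: "k \<le> j" by simp
    have jn: "j < n" using 4(2) h by simp
    have kn: "k < n" using k jn by simp
    have no: "I (Suc j) (S(''k'' := k, ''i'' := j, ''y'' := y, ''i'' := Suc j)) (A(''row'' := row)) \<tau>''"
      if "\<not> P y" "\<tau>'' \<le> \<tau>' + 50" for \<tau>''
    proof -
      have "S(''k'' := k, ''i'' := j, ''y'' := y, ''i'' := Suc j) = S(''k'' := k, ''i'' := Suc j, ''y'' := y)"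
        by (auto simp: fun_eq_iff)
      moreover have "map (\<lambda>j. row (a * n + j)) [0..<k] = filter P (map ?H [0..<Suc j])"
        using row that by simp
      moreover have "\<tau>'' \<le> \<tau> + 4 + 50 * Suc j" using that t by simp
      ultimately show ?thesis unfolding I_def using fr by blast
    qed
    have yes: "I (Suc j) (S(''k'' := k, ''i'' := j, ''y'' := y, ''k'' := Suc k, ''i'' := Suc j))
        (A(''row'' := row(a * n + k := y))) \<tau>''"
      if "P y" "\<tau>'' \<le> \<tau>' + 50" for \<tau>''
    proof -
      have "S(''k'' := k, ''i'' := j, ''y'' := y, ''k'' := Suc k, ''i'' := Suc j)
          = S(''k'' := Suc k, ''i'' := Suc j, ''y'' := y)"
        by (auto simp: fun_eq_iff)
      moreover have "map (\<lambda>j. (row(a * n + k := y)) (a * n + j)) [0..<k] = map (\<lambda>j. row (a * n + j)) [0..<k]"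
        by (intro map_cong) auto
      then have "map (\<lambda>j. (row(a * n + k := y)) (a * n + j)) [0..<Suc k] = filter P (map ?H [0..<Suc j])"
        using row that by simp
      moreover have "(row(a * n + k := y)) (x * n + i) = A ''row'' (x * n + i)" if "x \<noteq> a" "i < n" for x i
        using that fr kn by (simp add: cell_eq_iff)
      moreover have "\<tau>'' \<le> \<tau> + 4 + 50 * Suc j" using that t by simp
      ultimately show ?thesis unfolding I_def by blast
    qed
    show ?case
      apply (intro wp_intros)
      subgoal using a jn y by (simp add: S' A')
      subgoal using a y E2[OF y] by (simp add: S' A')
      subgoal using a kn by (simp add: S' A')
      subgoal using y by (simp add: S' A')
      subgoal using kn by (simp add: S' A')
      subgoal using a yes by (simp add: S' A' P_def split: if_splits)
      subgoal using a no by (simp add: S' A' P_def split: if_splits)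
      done
  next
    case (5 j S' A' \<tau>')
    then show ?case using a h unfolding I_def by auto
  next
    case (6 S' A' \<tau>')
    then obtain k r row where S': "S' = S(''k'' := k, ''i'' := ?h, ''y'' := r)" and A': "A' = A(''row'' := row)"
      and fr: "\<And>x j. x \<noteq> a \<Longrightarrow> j < n \<Longrightarrow> row (x * n + j) = A ''row'' (x * n + j)"
      and row: "map (\<lambda>j. row (a * n + j)) [0..<k] = filter P (map ?H [0..<?h])" and t: "\<tau>' \<le> \<tau> + 4 + 50 * ?h"
      unfolding I_def by blast
    have "length (map (\<lambda>j. row (a * n + j)) [0..<k]) \<le> length (map ?H [0..<?h])"
      unfolding row by (rule length_filter_le)
    then have k: "k \<le> n" using h by simp
    show ?case
      apply (intro wp_intros)
      subgoal using a by (simp add: S')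
      subgoal using k by (simp add: S')
      subgoal
        unfolding S' A'
        apply (simp)
        apply (rule Q')
        using fr row t h(1) by (auto simp: P_def)
      done
  qed
qed

lemma wp_check_row:
  assumes x: "S ''n'' = n" "S ''x'' < n" and len: "A ''rlen'' (S ''x'') \<le> n"
    and row: "\<And>j. j < A ''rlen'' (S ''x'') \<Longrightarrow>
      A ''row'' (S ''x'' * n + j) < n \<and> A ''excluded'' (A ''row'' (S ''x'' * n + j)) \<le> 1"
    and k: "S ''k'' \<le> 1"
    and Q: "\<And>p k \<tau>'. k \<le> 1 \<Longrightarrow> k = 0 \<longleftrightarrow> S ''k'' = 0 \<and>
         (\<forall>j<A ''rlen'' (S ''x''). A ''excluded'' (A ''row'' (S ''x'' * n + j)) \<noteq> 0) \<Longrightarrow>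
       \<tau>' \<le> \<tau> + 7 + 30 * A ''rlen'' (S ''x'') \<Longrightarrow> Q (S(''k'' := k, ''j'' := p)) A \<tau>'"
  shows "wp W check_row Q S A \<tau>"
proof -
  define x where "x = S ''x''"
  note x_def[symmetric, simp]
  note x = x[simplified]
  define I where "I = (\<lambda>j S' A' \<tau>'. (\<exists>k\<le>1. S' = S(''k'' := k, ''j'' := j) \<and>
      (k = 0 \<longleftrightarrow> S ''k'' = 0 \<and> (\<forall>i<j. A ''excluded'' (A ''row'' (x * n + i)) \<noteq> 0))) \<and> A' = A \<and>
      \<tau>' \<le> \<tau> + 2 + 30 * j)"
  show ?thesis unfolding check_row_def
  proof (rule wp_For[where N = "A ''rlen'' x" and I = I], goal_cases)
    case 1 show ?case by simp
  next
    case 2 show ?case using len by simp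
  next
    case 3
    have "S(''j'' := 0) = S(''k'' := S ''k'', ''j'' := 0)" by (auto simp: fun_eq_iff)
    then show ?case unfolding I_def using k by auto
  next
    case (4 j S' A' \<tau>')
    then obtain k where k: "k \<le> 1" "S' = S(''k'' := k, ''j'' := j)" "A' = A" "\<tau>' \<le> \<tau> + 2 + 30 * j"
      "k = 0 \<longleftrightarrow> S ''k'' = 0 \<and> (\<forall>i<j. A ''excluded'' (A ''row'' (x * n + i)) \<noteq> 0)"
      unfolding I_def by blast
    define y where "y = A ''row'' (x * n + j)"
    note y_def[symmetric, simp]
    have y: "y < n" "A ''excluded'' y \<le> 1" using row[of j] 4(2) by simp_all
    have jn: "j < n" using 4(2) len by simp
    have no: "I (Suc j) (S(''k'' := k, ''j'' := j, ''j'' := Suc j)) A \<tau>''"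
      if "A ''excluded'' y \<noteq> 0" "\<tau>'' \<le> \<tau>' + 30" for \<tau>''
      unfolding I_def using k that by (auto simp: less_Suc_eq)
    have yes: "I (Suc j) (S(''k'' := k, ''j'' := j, ''k'' := Suc 0, ''j'' := Suc j)) A \<tau>''"
      if "A ''excluded'' y = 0" "\<tau>'' \<le> \<tau>' + 30" for \<tau>''
    proof -
      have "S(''k'' := k, ''j'' := j, ''k'' := Suc 0, ''j'' := Suc j) = S(''k'' := Suc 0, ''j'' := Suc j)"
        by (auto simp: fun_eq_iff)
      moreover have "\<not> (\<forall>i<Suc j. A ''excluded'' (A ''row'' (x * n + i)) \<noteq> 0)"
        using that(1) by auto
      moreover have "\<tau>'' \<le> \<tau> + 2 + 30 * Suc j" using that k by simp
      ultimately show ?thesis unfolding I_def by (metis One_nat_def le_refl nat.distinct(1))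
    qed
    show ?case
      apply (intro wp_intros)
      subgoal using x jn y by (simp add: k)
      subgoal using x no[simplified] by (simp add: k)
      subgoal by simp
      subgoal using x yes by (simp add: k)
      done
  next
    case (5 j S' A' \<tau>')
    then show ?case using x len unfolding I_def by auto
  next
    case (6 S' A' \<tau>')
    then show ?case unfolding I_def by (auto intro!: Q)
  qed
qed

text \<open>Rows contain only vertices that come earlier in \<open>H\<close>, whose flags have
  already been renewed when they are read. So the heavy flags of the previous update are overwritten
  without a reset. The counters remain valid, as they ignore heavy vertices.\<close>

lemma wp_greedy:
  assumes base: "base n A" and dyn: "dyn n A" and n: "S ''n'' = n"
    and hv: "heavies_ok n (A ''heavy'') (A ''H'') (S ''hn'')"
    and rows: "rows_ok n (A ''E'') (A ''H'') (S ''hn'') (A ''row'') (A ''rlen'') {}"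
    and Q: "\<And>p q r s ex \<tau>'.
      (\<And>y. y < n \<Longrightarrow> A ''heavy'' y = 0 \<Longrightarrow> ex y = A ''excluded'' y) \<Longrightarrow> (\<And>y. y < n \<Longrightarrow> ex y \<le> 1) \<Longrightarrow>
      (\<And>i. i < S ''hn'' \<Longrightarrow> ex (A ''H'' i) = 0 \<longleftrightarrow> A ''c'' (A ''H'' i) = 0 \<and>
         (\<forall>k<i. 1 < A ''E'' (A ''H'' i * n + A ''H'' k) \<longrightarrow> ex (A ''H'' k) \<noteq> 0)) \<Longrightarrow>
      \<tau>' \<le> \<tau> + 6 + 40 * S ''hn'' + 30 * (\<Sum>i<S ''hn''. A ''rlen'' (A ''H'' i)) \<Longrightarrow>
      Q (S(''i'' := p, ''x'' := q, ''k'' := r, ''j'' := s)) (A(''excluded'' := ex)) \<tau>'"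
  shows "wp W greedy Q S A \<tau>"
proof -
  define hn where "hn = S ''hn''"
  note hn_def[symmetric, simp]
  note hv = hv[simplified] and rows = rows[simplified] and Q' = Q[simplified]
  let ?H = "A ''H''" and ?E = "A ''E''" and ?row = "A ''row''" and ?rlen = "A ''rlen''"
  have hnn: "hn \<le> n" using heavies_ok_le[OF hv] .
  have H: "?H i < n" "A ''heavy'' (?H i) = Suc i" if "i < hn" for i
    using hv that unfolding heavies_ok_def by auto
  have row: "map (\<lambda>j. ?row (?H i * n + j)) [0..<?rlen (?H i)] =
      filter (\<lambda>y. 1 < ?E (?H i * n + y)) (map ?H [0..<i])" if "i < hn" for i
    using rows that unfolding rows_ok_def by simp
  have row_set: "(\<lambda>j. ?row (?H i * n + j)) ` {..<?rlen (?H i)} = ?H ` {k. k < i \<and> 1 < ?E (?H i * n + ?H k)}"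
    if "i < hn" for i
    using arg_cong[OF row[OF that], of set] by (auto simp: atLeast0LessThan)
  have row_len: "?rlen (?H i) \<le> i" if "i < hn" for i
  proof -
    have "length (map (\<lambda>j. ?row (?H i * n + j)) [0..<?rlen (?H i)]) \<le> length (map ?H [0..<i])"
      unfolding row[OF that] by (rule length_filter_le)
    then show ?thesis by simp
  qed
  define I where "I = (\<lambda>i S' A' \<tau>'. (\<exists>q r s. S' = S(''i'' := i, ''x'' := q, ''k'' := r, ''j'' := s)) \<and>
      (\<exists>ex. A' = A(''excluded'' := ex) \<and> (\<forall>y<n. y \<notin> ?H ` {..<i} \<longrightarrow> ex y = A ''excluded'' y) \<and>
         (\<forall>y<n. ex y \<le> 1) \<and>
         (\<forall>j<i. ex (?H j) = 0 \<longleftrightarrow> A ''c'' (?H j) = 0 \<and>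
            (\<forall>k<j. 1 < ?E (?H j * n + ?H k) \<longrightarrow> ex (?H k) \<noteq> 0))) \<and>
      \<tau>' \<le> \<tau> + 2 + 40 * i + 30 * (\<Sum>j<i. ?rlen (?H j)))"
  show ?thesis unfolding greedy_def
  proof (rule wp_For[where N = hn and I = I], goal_cases)
    case 1 show ?case by simp
  next
    case 2 show ?case using hnn by simp
  next
    case 3
    have "S(''i'' := 0) = S(''i'' := 0, ''x'' := S ''x'', ''k'' := S ''k'', ''j'' := S ''j'')"
      by (auto simp: fun_eq_iff)
    then show ?case unfolding I_def using dyn by (auto simp: dyn_def intro!: exI[of _ "A ''excluded''"])
  next
    case (4 i S' A' \<tau>')
    then obtain q r s ex where S': "S' = S(''i'' := i, ''x'' := q, ''k'' := r, ''j'' := s)"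
      and A': "A' = A(''excluded'' := ex)" and fr: "\<forall>y<n. y \<notin> ?H ` {..<i} \<longrightarrow> ex y = A ''excluded'' y"
      and ex1: "\<forall>y<n. ex y \<le> 1"
      and gr: "\<And>j. j < i \<Longrightarrow> ex (?H j) = 0 \<longleftrightarrow> A ''c'' (?H j) = 0 \<and>
            (\<forall>k<j. 1 < ?E (?H j * n + ?H k) \<longrightarrow> ex (?H k) \<noteq> 0)"
      and t: "\<tau>' \<le> \<tau> + 2 + 40 * i + 30 * (\<Sum>j<i. ?rlen (?H j))"
      unfolding I_def by blast
    define x where "x = ?H i"
    note x_def[symmetric, simp]
    have x: "x < n" using H[OF 4(2)] by simp
    have i: "i < n" using 4(2) hnn by simp
    have neq: "?H j \<noteq> x" if "j < i" for j
      using H(2)[of j] H(2)[of i] that 4(2) by auto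
    have cx: "A ''c'' x \<le> n" using dyn_fits(1)[OF dyn base x] .
    have rl: "?rlen x \<le> n" using row_len[OF 4(2)] i by simp
    have elem: "?row (x * n + j) < n" if "j < ?rlen x" for j
    proof -
      have "?row (x * n + j) \<in> ?H ` {..<i}" using row_set[OF 4(2)] that by auto
      then show ?thesis using H(1) 4(2) by auto
    qed
    have fin: "I (Suc i) (S(''i'' := i, ''x'' := q', ''k'' := k, ''j'' := p, ''i'' := Suc i))
        (A(''excluded'' := ex(x := k))) \<tau>''"
      if k: "k \<le> 1" "k = 0 \<longleftrightarrow> A ''c'' x = 0 \<and> (\<forall>j<?rlen x. ex (?row (x * n + j)) \<noteq> 0)"
        and t': "\<tau>'' \<le> \<tau>' + 40 + 30 * ?rlen x" for q' k p \<tau>''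
    proof -
      have "S(''i'' := i, ''x'' := q', ''k'' := k, ''j'' := p, ''i'' := Suc i)
          = S(''i'' := Suc i, ''x'' := q', ''k'' := k, ''j'' := p)"
        by (auto simp: fun_eq_iff)
      moreover have "\<forall>y<n. y \<notin> ?H ` {..<Suc i} \<longrightarrow> (ex(x := k)) y = A ''excluded'' y"
        using fr by (auto simp: lessThan_Suc)
      moreover have "\<forall>y<n. (ex(x := k)) y \<le> 1" using ex1 k by simp
      moreover have "\<tau>'' \<le> \<tau> + 2 + 40 * Suc i + 30 * (\<Sum>j<Suc i. ?rlen (?H j))" using t t' by simp
      moreover have "\<forall>j<Suc i. (ex(x := k)) (?H j) = 0 \<longleftrightarrow> A ''c'' (?H j) = 0 \<and>
            (\<forall>l<j. 1 < ?E (?H j * n + ?H l) \<longrightarrow> (ex(x := k)) (?H l) \<noteq> 0)"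
      proof (intro allI impI)
        fix j assume "j < Suc i"
        then consider "j < i" | "j = i" by linarith
        then show "(ex(x := k)) (?H j) = 0 \<longleftrightarrow> A ''c'' (?H j) = 0 \<and>
            (\<forall>l<j. 1 < ?E (?H j * n + ?H l) \<longrightarrow> (ex(x := k)) (?H l) \<noteq> 0)"
        proof cases
          case 1 with gr[OF 1] neq show ?thesis by auto
        next
          case 2
          have "(\<forall>j<?rlen x. ex (?row (x * n + j)) \<noteq> 0) \<longleftrightarrow>
              (\<forall>y\<in>(\<lambda>j. ?row (x * n + j)) ` {..<?rlen x}. ex y \<noteq> 0)" by auto
          also have "\<dots> \<longleftrightarrow> (\<forall>l<i. 1 < ?E (x * n + ?H l) \<longrightarrow> ex (?H l) \<noteq> 0)"
            using row_set[OF 4(2)] by auto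
          finally show ?thesis using 2 k neq by auto
        qed
      qed
      ultimately show ?thesis unfolding I_def by blast
    qed
    have S2: "S(''i'' := i, ''x'' := q, ''k'' := r, ''j'' := s, ''x'' := x, ''k'' := k', ''k'' := k, ''j'' := p)
       = S(''i'' := i, ''x'' := x, ''k'' := k, ''j'' := p)" for k k' p
      by (auto simp: fun_eq_iff)
    show ?case
      apply (intro wp_intros)
      subgoal using x i by (simp add: S' A')
      subgoal using cx x by (simp add: S' A')
      subgoal
        apply (rule wp_check_row)
        subgoal using n by (simp add: S' A')
        subgoal using x by (simp add: S' A')
        subgoal using rl by (simp add: S' A')
        subgoal using elem ex1 by (simp add: S' A')
        subgoal by (simp add: S' A')
        subgoal for p k \<tau>''
          apply (intro wp_intros)
          subgoal using x by (simp add: S' A')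
          subgoal by (simp add: S' A')
          subgoal
            using fin[of k _ x p] by (simp add: S' A' S2[simplified] split: if_splits)
          done
        done
      done
  next
    case (5 j S' A' \<tau>')
    then show ?case using n hnn unfolding I_def by auto
  next
    case (6 S' A' \<tau>')
    then obtain q r s ex where S': "S' = S(''i'' := hn, ''x'' := q, ''k'' := r, ''j'' := s)"
      and A': "A' = A(''excluded'' := ex)" and fr: "\<forall>y<n. y \<notin> ?H ` {..<hn} \<longrightarrow> ex y = A ''excluded'' y"
      and ex1: "\<forall>y<n. ex y \<le> 1"
      and gr: "\<And>j. j < hn \<Longrightarrow> ex (?H j) = 0 \<longleftrightarrow> A ''c'' (?H j) = 0 \<and>
            (\<forall>k<j. 1 < ?E (?H j * n + ?H k) \<longrightarrow> ex (?H k) \<noteq> 0)"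
      and t: "\<tau>' \<le> \<tau> + 2 + 40 * hn + 30 * (\<Sum>j<hn. ?rlen (?H j))"
      unfolding I_def by blast
    have "y \<notin> ?H ` {..<hn}" if "A ''heavy'' y = 0" for y
      using H(2) that by auto
    with fr ex1 gr t show ?case unfolding S' A' by (intro Q') auto
  qed
qed

end

section \<open>The phases of an update\<close>

text \<open>With both endpoints outside the set, the edge change and the promotions leave all counts valid.\<close>

definition detach_phase :: com where
  "detach_phase = Assign ''x'' (Var ''u'') ;; leave ;; Assign ''x'' (Var ''v'') ;; leave"

definition link_phase :: com where
  "link_phase =
     Assign ''a'' (Var ''u'') ;; Assign ''b'' (Var ''v'') ;; link ;;
     Assign ''a'' (Var ''v'') ;; Assign ''b'' (Var ''u'') ;; link"

text \<open>The flags \<open>fu\<close> and \<open>fv\<close> remember which endpoints were low before the promotions: the neighbours of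
  these may have lost their last neighbour in the set when the endpoints were detached.\<close>

definition promote_phase :: com where
  "promote_phase =
     Assign ''fu'' (Op Less (Get ''heavy'' (Var ''u'')) (Const 1)) ;;
     Assign ''fv'' (Op Less (Get ''heavy'' (Var ''v'')) (Const 1)) ;;
     Assign ''a'' (Var ''u'') ;; promote ;; Assign ''a'' (Var ''v'') ;; promote"

definition fix_phase :: com where
  "fix_phase =
     Cond (Var ''fu'') (Assign ''a'' (Var ''u'') ;; fix_com) Skip ;;
     Cond (Var ''fv'') (Assign ''a'' (Var ''v'') ;; fix_com) Skip ;;
     (Assign ''x'' (Var ''u'') ;; enter) ;; (Assign ''x'' (Var ''v'') ;; enter)"

text \<open>Two rows suffice. The edge change concerns only the rows of its endpoints, and newly
  promoted vertices, which are endpoints too, come last in \<open>H\<close> and thus appear in no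
  row of an older heavy vertex.\<close>

definition heavy_phase :: com where
  "heavy_phase =
     Assign ''a'' (Var ''u'') ;; scan_row ;; Assign ''a'' (Var ''v'') ;; scan_row ;; greedy"

definition mis_update :: com where
  "mis_update =
     Assign ''t'' (Op Add (Var ''t'') (Const 1)) ;;
     detach_phase ;; link_phase ;; promote_phase ;; fix_phase ;; heavy_phase"

text \<open>The registers that no phase writes.\<close>

definition regs :: "(vname \<Rightarrow> nat) \<Rightarrow> nat \<times> nat \<times> nat \<times> nat \<times> nat \<times> nat" where
  "regs S = (S ''n'', S ''lambda'', S ''insert'', S ''u'', S ''v'', S ''t'')"

definition mass :: "nat \<Rightarrow> (nat \<Rightarrow> nat) \<Rightarrow> (nat \<Rightarrow> nat) \<Rightarrow> nat" where
  "mass n hv len = (\<Sum>x | x < n \<and> hv x = 0. len x)"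

text \<open>The slack grows by more than the two list entries that an update may add to \<open>M\<close>, the total length
  of the lists of low vertices; a promotion exchanges a list of length above \<open>sqrt (lam * t)\<close> for one
  unit of \<open>hn\<close>. At \<open>t = 0\<close> the division by zero yields 0.\<close>

definition few_heavy :: "nat \<Rightarrow> nat \<Rightarrow> nat \<Rightarrow> nat \<Rightarrow> bool" where
  "few_heavy lam t hn M \<longleftrightarrow> real hn * sqrt lam + real M / sqrt t \<le> 4 * sqrt t"

text \<open>Let \<open>r\<close> and \<open>s\<close> be the roots of \<open>t\<close> and
  \<open>Suc t\<close>. From \<open>(s - r) * (s + r) = 1\<close> follows
  \<open>1 / s \<le> 2 * (s - r)\<close>, so the weight \<open>2 / s\<close> of two new entries fits
  into the growth \<open>4 * (s - r)\<close> of the right-hand side. This is the origin of the 4. At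
  \<open>t = 0\<close> the weight of \<open>M\<close> vanishes by convention, and
  \<open>M = 0\<close> has to be assumed.\<close>

lemma few_heavy_Suc:
  assumes "few_heavy lam t hn M" "M' \<le> M + 2" "t = 0 \<Longrightarrow> M = 0"
  shows "few_heavy lam (Suc t) hn M'"
proof -
  let ?r = "sqrt (real t)" and ?s = "sqrt (real (Suc t))"
  have s: "?s > 0" by simp
  have rs: "?r \<le> ?s" by simp
  have "real M / ?s \<le> real M / ?r"
  proof (cases "t = 0")
    case False
    then show ?thesis using rs by (intro divide_left_mono) auto
  qed (use assms(3) in simp)
  have "(?s - ?r) * (?s + ?r) = 1" by (simp add: algebra_simps)
  moreover have "(?s - ?r) * (?s + ?r) \<le> (?s - ?r) * (2 * ?s)" using rs by (intro mult_left_mono) auto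
  ultimately have "1 \<le> (?s - ?r) * (2 * ?s)" by linarith
  moreover have "1 / s \<le> 2 * (s - r)" if "1 \<le> (s - r) * (2 * s)" "0 < s" for r s :: real
    using that by (simp add: field_simps)
  ultimately have "1 / ?s \<le> 2 * (?s - ?r)" using s by blast
  moreover have "real M' / ?s \<le> (real M + 2) / ?s" using assms(2) s by (intro divide_right_mono) auto
  then have "real M' / ?s \<le> real M / ?s + 2 * (1 / ?s)" by (simp add: add_divide_distrib)
  ultimately show ?thesis
    using assms(1) \<open>real M / ?s \<le> real M / ?r\<close> unfolding few_heavy_def by argo
qed

lemma few_heavy_promote:
  assumes "few_heavy lam t hn M" "M = M' + l" "lam * t < l\<^sup>2" "0 < t"
  shows "few_heavy lam t (Suc hn) M'"
proof -
  have "real (lam * t) < (real l)\<^sup>2" using assms(3) by (metis of_nat_less_iff of_nat_power)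
  then have "sqrt (real (lam * t)) < real l" using real_sqrt_less_iff[of "real (lam * t)" "(real l)\<^sup>2"] by simp
  then have "sqrt lam * sqrt t \<le> real l" by (simp add: real_sqrt_mult)
  then have "sqrt lam \<le> real l / sqrt t" using assms(4) by (simp add: field_simps)
  then show ?thesis using assms(1) unfolding few_heavy_def assms(2)
    by (simp add: add_divide_distrib algebra_simps)
qed

lemma mass_promote:
  assumes "a < n" "hv a = 0" "0 < h"
  shows "mass n hv len = mass n (hv(a := h)) len + len a"
proof -
  let ?T = "{x. x < n \<and> hv x = 0}"
  have "{x. x < n \<and> (hv(a := h)) x = 0} = ?T - {a}" using assms by auto
  then show ?thesis unfolding mass_def using assms by (simp add: sum.remove[of ?T a])
qed

lemma mass_link:
  assumes "\<And>x. x \<noteq> u \<Longrightarrow> x \<noteq> v \<Longrightarrow> len' x = len x" "len' u \<le> len u + 1" "len' v \<le> len v + 1" "u \<noteq> v"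
  shows "mass n hv len' \<le> mass n hv len + 2"
proof -
  let ?T = "{x. x < n \<and> hv x = 0}"
  have "mass n hv len' \<le> (\<Sum>x\<in>?T. len x + ((if x = u then 1 else 0) + (if x = v then 1 else 0)))"
    unfolding mass_def using assms(1-3) by (intro sum_mono) auto
  also have "\<dots> = mass n hv len + ((if u \<in> ?T then 1 else 0) + (if v \<in> ?T then 1 else 0))"
    unfolding mass_def by (simp add: sum.distrib)
  also have "\<dots> \<le> mass n hv len + 2" by simp
  finally show ?thesis .
qed

section \<open>Correctness and cost of the phases\<close>

context word_size
begin

lemma wp_detach_phase:
  assumes base: "base n A" and dyn: "dyn n A" and r: "regs S = (n, lam, ins, u, v, t)"
    and uv: "u < n" "v < n" "u \<noteq> v" and sus: "suspects n A = {}"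
    and D: "\<And>x. x < n \<Longrightarrow> A ''heavy'' x = 0 \<Longrightarrow> A ''len'' x \<le> D"
    and Q: "\<And>S' ex c A' \<tau>'. regs S' = regs S \<Longrightarrow> S' ''hn'' = S ''hn'' \<Longrightarrow>
      A' = A(''excluded'' := ex, ''c'' := c) \<Longrightarrow> dyn n A' \<Longrightarrow>
      suspects n A' \<subseteq> {w. \<exists>x\<in>{u, v}. A ''heavy'' x = 0 \<and> (w = x \<or> w < n \<and> 1 < A ''E'' (x * n + w))} \<Longrightarrow>
      (\<And>x. x \<in> {u, v} \<Longrightarrow> A ''heavy'' x = 0 \<Longrightarrow> ex x \<noteq> 0) \<Longrightarrow>
      low_out n A' \<le> low_out n A + 2 \<Longrightarrow> \<tau>' \<le> \<tau> + 50 + 62 * D \<Longrightarrow> Q S' A' \<tau>'"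
  shows "wp W detach_phase Q S A \<tau>"
  unfolding detach_phase_def
  apply (intro wp_intros)
  subgoal using uv r by (simp add: regs_def)
  apply (rule wp_leave)
  subgoal by (rule base)
  subgoal by (rule dyn)
  subgoal using r by (simp add: regs_def)
  subgoal using uv r by (simp add: regs_def)
  subgoal for p q c A1 x \<tau>1
    apply (intro wp_intros)
    subgoal using uv r by (simp add: regs_def)
    apply (rule wp_leave)
    subgoal using base by simp
    subgoal by simp
    subgoal using r by (simp add: regs_def)
    subgoal using uv r by (simp add: regs_def)
    subgoal premises prems for p' q' c' A2 x' \<tau>2
    proof -
      have x: "x = u" "x' = v" using prems r by (auto simp: regs_def)
      have "31 * A ''len'' v \<le> 31 * D" if "A ''heavy'' v = 0" using D[OF uv(2) that] by simp
      moreover have "31 * A ''len'' u \<le> 31 * D" if "A ''heavy'' u = 0" using D[OF uv(1) that] by simp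
      ultimately have t: "\<tau>2 \<le> \<tau> + 50 + 62 * D" using prems(6,12) unfolding x prems(2)
        by (auto split: if_splits)
      have A1: "A1 ''heavy'' = A ''heavy''" "A1 ''E'' = A ''E''" unfolding prems(2) by simp_all
      have e: "A2 = A(''excluded'' := A2 ''excluded'', ''c'' := c')"
        unfolding prems(2,8) by (auto simp: fun_eq_iff)
      show ?thesis
      proof (rule Q[OF _ _ e prems(9) _ _ _ t])
        show "suspects n A2 \<subseteq> {w. \<exists>x\<in>{u, v}. A ''heavy'' x = 0 \<and> (w = x \<or> w < n \<and> 1 < A ''E'' (x * n + w))}"
          using prems(4,10) sus unfolding x A1 by blast
        show "A2 ''excluded'' y \<noteq> 0" if "y \<in> {u, v}" "A ''heavy'' y = 0" for y
          unfolding prems(8) x prems(2) using that by auto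
      qed (use prems(5,11) in \<open>auto simp: regs_def\<close>)
    qed
    done
  done

lemma wp_link_phase:
  assumes base: "base n A" and r: "regs S = (n, lam, ins, u, v, t)" and ins: "ins \<le> 1"
    and uv: "u < n" "v < n" "u \<noteq> v" and irr: "\<And>a. a < n \<Longrightarrow> A ''E'' (a * n + a) = 0"
    and Q: "\<And>S' L' len' A' \<tau>'. regs S' = regs S \<Longrightarrow> S' ''hn'' = S ''hn'' \<Longrightarrow>
      A' = A(''L'' := L', ''len'' := len',
        ''E'' := (A ''E'')(u * n + v := Suc ins, v * n + u := Suc ins)) \<Longrightarrow> base n A' \<Longrightarrow>
      (\<And>y. y \<noteq> u \<Longrightarrow> y \<noteq> v \<Longrightarrow> len' y = A ''len'' y) \<Longrightarrow>
      len' u \<le> A ''len'' u + 1 \<Longrightarrow> len' v \<le> A ''len'' v + 1 \<Longrightarrow> \<tau>' \<le> \<tau> + 100 \<Longrightarrow> Q S' A' \<tau>'"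
  shows "wp W link_phase Q S A \<tau>"
  unfolding link_phase_def
  apply (intro wp_intros)
  subgoal using uv r by (simp add: regs_def)
  subgoal using uv r by (simp add: regs_def)
  apply (rule wp_link)
  subgoal by (rule base)
  subgoal using r by (simp add: regs_def)
  subgoal using uv r by (simp add: regs_def)
  subgoal using uv r by (simp add: regs_def)
  subgoal using uv r by (simp add: regs_def)
  subgoal using uv r irr by (simp add: regs_def)
  subgoal using r ins by (simp add: regs_def)
  subgoal for L1 len1 A1 \<tau>1
    apply (intro wp_intros)
    subgoal using uv r by (simp add: regs_def)
    subgoal using uv r by (simp add: regs_def)
    apply (rule wp_link)
    subgoal by simp
    subgoal using r by (simp add: regs_def)
    subgoal using uv r by (simp add: regs_def)
    subgoal using uv r by (simp add: regs_def)
    subgoal using uv r by (simp add: regs_def)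
    subgoal using uv r irr by (simp add: regs_def cell_eq_iff)
    subgoal using r ins by (simp add: regs_def)
    subgoal premises prems for L2 len2 A2 \<tau>2
    proof -
      have e: "A2 = A(''L'' := L2, ''len'' := len2,
        ''E'' := (A ''E'')(u * n + v := Suc ins, v * n + u := Suc ins))"
        using prems(1,6) r by (auto simp: regs_def fun_eq_iff)
      have l1: "A1 ''len'' = len1" using prems(1) by simp
      have len1: "len1 y = A ''len'' y" if "y \<noteq> u" for y using prems(3)[of y] that r by (simp add: regs_def)
      have len1u: "len1 u \<le> A ''len'' u + 1" using prems(4) r by (simp add: regs_def)
      have len2: "len2 y = len1 y" if "y \<noteq> v" for y using prems(8)[of y] that r l1 by (simp add: regs_def)
      have len2v: "len2 v \<le> len1 v + 1" using prems(9) r l1 by (simp add: regs_def)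
      show ?thesis
        by (rule Q[OF _ _ e prems(7)])
          (use prems(5,10) len1 len2 len1u len2v uv(3) in \<open>auto simp: regs_def\<close>)
    qed
    done
  done

text \<open>Covers both outcomes of \<open>promote\<close>, so that the calls for the two endpoints
  compose by \<open>promoted_trans\<close>. That \<open>H\<close> keeps its old prefix is what saves
  the rows of the older heavy vertices.\<close>

definition promoted ::
  "nat set \<Rightarrow> nat \<Rightarrow> (vname \<Rightarrow> nat \<Rightarrow> nat) \<Rightarrow> nat \<Rightarrow> (vname \<Rightarrow> nat \<Rightarrow> nat) \<Rightarrow> nat \<Rightarrow> bool" where
  "promoted Z t A hn A' hn' \<longleftrightarrow>
     A' = A(''H'' := A' ''H'', ''heavy'' := A' ''heavy'') \<and> base n A' \<and>
     heavies_ok n (A' ''heavy'') (A' ''H'') hn' \<and>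
     few_heavy lam t hn' (mass n (A' ''heavy'') (A' ''len'')) \<and>
     hn \<le> hn' \<and> (\<forall>i<hn. A' ''H'' i = A ''H'' i) \<and> (\<forall>i<hn'. hn \<le> i \<longrightarrow> A' ''H'' i \<in> Z) \<and>
     (\<forall>y. y \<notin> Z \<or> 0 < A ''heavy'' y \<longrightarrow> A' ''heavy'' y = A ''heavy'' y) \<and>
     (\<forall>x\<in>Z. A' ''heavy'' x = 0 \<longrightarrow> (A' ''len'' x)\<^sup>2 \<le> lam * t)"

lemma wp_promote_step:
  assumes base: "base n A" and hv: "heavies_ok n (A ''heavy'') (A ''H'') (S ''hn'')"
    and few: "few_heavy lam t (S ''hn'') (mass n (A ''heavy'') (A ''len''))"
    and a: "S ''n'' = n" "S ''a'' < n" "S ''lambda'' = lam" "S ''t'' = t" "0 < t" "t \<le> m"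
    and Q: "\<And>h A' \<tau>'. promoted {S ''a''} t A (S ''hn'') A' h \<Longrightarrow> \<tau>' \<le> \<tau> + 30 \<Longrightarrow>
      Q (S(''hn'' := h)) A' \<tau>'"
  shows "wp W promote Q S A \<tau>"
  apply (rule wp_promote)
  subgoal by (rule base)
  subgoal by (rule hv)
  subgoal by (rule a)
  subgoal by (rule a)
  subgoal by (rule a)
  subgoal using a by simp
  subgoal premises prems for \<tau>'
  proof (rule Q[OF _ prems(3)])
    let ?A = "A(''H'' := (A ''H'')(S ''hn'' := S ''a''), ''heavy'' := (A ''heavy'')(S ''a'' := Suc (S ''hn'')))"
    have ok: "heavies_ok n (?A ''heavy'') (?A ''H'') (Suc (S ''hn''))"
      using heavies_ok_promote[OF hv a(2) prems(1)] by simp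
    have "base n ?A"
      using base heavies_ok_le[OF ok] by (simp add: base_def)
    moreover have "few_heavy lam t (Suc (S ''hn'')) (mass n (?A ''heavy'') (?A ''len''))"
      using few_heavy_promote[OF few mass_promote[where hv = "A ''heavy''" and h = "Suc (S ''hn'')", OF a(2) prems(1)]]
        prems(2) a by simp
    ultimately show "promoted {S ''a''} t A (S ''hn'') ?A (Suc (S ''hn''))"
      using ok prems unfolding promoted_def by (auto simp: less_Suc_eq)
  qed
  subgoal premises prems for \<tau>'
  proof -
    have "promoted {S ''a''} t A (S ''hn'') A (S ''hn'')"
      using base hv few prems(1) a unfolding promoted_def by auto
    from Q[OF this prems(2)] show ?thesis by simp
  qed
  done

lemma promoted_trans:
  assumes 1: "promoted Y t A h A' h'" and 2: "promoted Z t A' h' A'' h''"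
  shows "promoted (Y \<union> Z) t A h A'' h''"
proof -
  have e: "A'' = A(''H'' := A'' ''H'', ''heavy'' := A'' ''heavy'')"
  proof -
    obtain H' hv' H'' hv'' where "A' = A(''H'' := H', ''heavy'' := hv')" "A'' = A'(''H'' := H'', ''heavy'' := hv'')"
      using 1 2 unfolding promoted_def by blast
    then have "A'' = A(''H'' := H'', ''heavy'' := hv'')" by (auto simp: fun_eq_iff)
    then show ?thesis by simp
  qed
  have len: "A'' ''len'' = A' ''len''"
  proof -
    have "A'' = A'(''H'' := A'' ''H'', ''heavy'' := A'' ''heavy'')" using 2 unfolding promoted_def by blast
    from fun_cong[OF this, of "''len''"] show ?thesis by simp
  qed
  note 1 = 1[unfolded promoted_def] and 2 = 2[unfolded promoted_def]
  have "A'' ''H'' i \<in> Y \<union> Z" if "h \<le> i" "i < h''" for i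
    using 1 2 that by (cases "i < h'") auto
  moreover have "(A'' ''len'' x)\<^sup>2 \<le> lam * t" if x: "x \<in> Y \<union> Z" "A'' ''heavy'' x = 0" for x
  proof (cases "x \<in> Z")
    case False
    then have "A'' ''heavy'' x = A' ''heavy'' x" using 2 by blast
    with x False 1 show ?thesis by (simp add: len)
  qed (use 2 x in blast)
  moreover have "A'' ''heavy'' y = A ''heavy'' y" if y: "y \<notin> Y \<union> Z \<or> 0 < A ''heavy'' y" for y
  proof -
    have "A' ''heavy'' y = A ''heavy'' y" using 1 y by blast
    moreover have "A'' ''heavy'' y = A' ''heavy'' y" using 2 y calculation by (metis UnI2)
    ultimately show ?thesis by simp
  qed
  moreover have "\<forall>i<h. A'' ''H'' i = A ''H'' i" using 1 2 by simp
  moreover have "h \<le> h''" using 1 2 by linarith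
  ultimately show ?thesis using e 2 unfolding promoted_def by blast
qed

lemma wp_promote_phase:
  assumes base: "base n A" and hv: "heavies_ok n (A ''heavy'') (A ''H'') (S ''hn'')"
    and few: "few_heavy lam t (S ''hn'') (mass n (A ''heavy'') (A ''len''))"
    and r: "regs S = (n, lam, ins, u, v, t)" and t: "0 < t" "t \<le> m" and uv: "u < n" "v < n"
    and Q: "\<And>S' A' \<tau>'. regs S' = regs S \<Longrightarrow> promoted {u, v} t A (S ''hn'') A' (S' ''hn'') \<Longrightarrow>
      (S' ''fu'' = 0 \<longleftrightarrow> A ''heavy'' u \<noteq> 0) \<Longrightarrow> (S' ''fv'' = 0 \<longleftrightarrow> A ''heavy'' v \<noteq> 0) \<Longrightarrow>
      S' ''fu'' \<le> 1 \<Longrightarrow> S' ''fv'' \<le> 1 \<Longrightarrow> \<tau>' \<le> \<tau> + 100 \<Longrightarrow> Q S' A' \<tau>'"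
  shows "wp W promote_phase Q S A \<tau>"
proof -
  have h: "A ''heavy'' x < W" if "x < n" for x using base that by (simp add: base_def)
  show ?thesis
  unfolding promote_phase_def
  apply (intro wp_intros)
  subgoal using uv r h by (simp add: regs_def)
  subgoal using uv r h by (simp add: regs_def)
  subgoal using uv r by (simp add: regs_def)
  apply (rule wp_promote_step[where t = t])
  subgoal by (rule base)
  subgoal using hv by simp
  subgoal using few by simp
  subgoal using r by (simp add: regs_def)
  subgoal using uv r by (simp add: regs_def)
  subgoal using r by (simp add: regs_def)
  subgoal using r by (simp add: regs_def)
  subgoal by (rule t)
  subgoal by (rule t)
  subgoal for h1 A1 \<tau>1
    apply (intro wp_intros)
    subgoal using uv r by (simp add: regs_def)
    apply (rule wp_promote_step[where t = t])
    subgoal by (simp add: promoted_def)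
    subgoal by (simp add: promoted_def)
    subgoal by (simp add: promoted_def)
    subgoal using r by (simp add: regs_def)
    subgoal using uv r by (simp add: regs_def)
    subgoal using r by (simp add: regs_def)
    subgoal using r by (simp add: regs_def)
    subgoal by (rule t)
    subgoal by (rule t)
    subgoal premises prems for h2 A2 \<tau>2
    proof -
      have 1: "promoted {u} t A (S ''hn'') A1 h1" "promoted {v} t A1 h1 A2 h2"
        using prems(1,3) r by (simp_all add: regs_def)
      have "{u} \<union> {v} = {u, v}" by auto
      with promoted_trans[OF 1] have 2: "promoted {u, v} t A (S ''hn'') A2 h2" by simp
      show ?thesis
        by (rule Q) (use 2 r prems(2,4) in \<open>auto simp: regs_def\<close>)
    qed
    done
  done
qed

text \<open>\<open>fu\<close> and \<open>fv\<close> are separate hypotheses because \<open>D\<close>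
  bounds the lists of low vertices only: an endpoint that has just been promoted is heavy, yet its
  neighbours have to be repaired.\<close>

lemma wp_fix_phase:
  assumes base: "base n A" and dyn: "dyn n A" and sym: "adj_sym n (A ''E'')"
    and r: "regs S = (n, lam, ins, u, v, t)" and uv: "u < n" "v < n"
    and D: "\<And>x. x < n \<Longrightarrow> A ''heavy'' x = 0 \<Longrightarrow> A ''len'' x \<le> D"
    and fu: "S ''fu'' \<noteq> 0 \<Longrightarrow> A ''len'' u \<le> D" and fv: "S ''fv'' \<noteq> 0 \<Longrightarrow> A ''len'' v \<le> D"
    and f: "S ''fu'' \<le> 1" "S ''fv'' \<le> 1"
    and sus: "suspects n A \<subseteq> {w. w = u \<or> w = v \<or> S ''fu'' \<noteq> 0 \<and> w < n \<and> 0 < A ''E'' (u * n + w) \<or>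
        S ''fv'' \<noteq> 0 \<and> w < n \<and> 0 < A ''E'' (v * n + w)}"
    and Q: "\<And>S' ex c A' \<tau>'. regs S' = regs S \<Longrightarrow> S' ''hn'' = S ''hn'' \<Longrightarrow>
      A' = A(''excluded'' := ex, ''c'' := c) \<Longrightarrow> dyn n A' \<Longrightarrow> suspects n A' = {} \<Longrightarrow>
      \<tau>' + low_out n A' * (31 * D + 20) \<le> \<tau> + 100 + 80 * D + low_out n A * (31 * D + 20) \<Longrightarrow>
      Q S' A' \<tau>'"
  shows "wp W fix_phase Q S A \<tau>"
proof -
  let ?E = "A ''E''" and ?K = "31 * D + 20"
  \<comment> \<open>Steps compose by uniting the cleared sets \<open>Z\<close> and adding the times
    \<open>T\<close>. Two scans at \<open>15 + 40 * D\<close> and two entries at 25 stay within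
    \<open>100 + 80 * D\<close>, and the four sets cover all suspects.\<close>
  define step where "step = (\<lambda>Z T S A S' A' \<tau> \<tau>'. regs S' = regs S \<and> S' ''hn'' = S ''hn'' \<and>
      S' ''fv'' = S ''fv'' \<and> (\<exists>ex c. A' = A(''excluded'' := ex, ''c'' := c)) \<and> dyn n A' \<and>
      suspects n A' \<subseteq> suspects n A - Z \<and> \<tau>' + low_out n A' * ?K \<le> \<tau> + T + low_out n A * ?K)"
  have same: "\<exists>ex c. A = A(''excluded'' := ex, ''c'' := c)" for A :: "vname \<Rightarrow> nat \<Rightarrow> nat"
    by (rule exI[of _ "A ''excluded''"], rule exI[of _ "A ''c''"]) simp
  have step_trans: "step (Y \<union> Z) (T + T') S A S'' A'' \<tau> \<tau>''" if "step Y T S A S' A' \<tau> \<tau>'" "step Z T' S' A' S'' A'' \<tau>' \<tau>''"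
    for Y Z T T' S S' S'' A A' A'' \<tau> \<tau>' \<tau>''
  proof -
    from that obtain ex c ex' c' where "A' = A(''excluded'' := ex, ''c'' := c)" "A'' = A'(''excluded'' := ex', ''c'' := c')"
      unfolding step_def by blast
    then have "A'' = A(''excluded'' := ex', ''c'' := c')" by (auto simp: fun_eq_iff)
    with that show ?thesis unfolding step_def by (auto 0 3)
  qed
  have fix_step: "wp W (Cond (Var f) (Assign ''a'' (Var x) ;; fix_com) Skip) R S1 A1 \<tau>1"
    if "regs S1 = regs S" "x = ''u'' \<or> x = ''v''" "S1 f \<noteq> 0 \<Longrightarrow> A ''len'' (S x) \<le> D" "S1 f \<le> 1"
      "\<exists>ex c. A1 = A(''excluded'' := ex, ''c'' := c)" "dyn n A1"
      "\<And>S' A' \<tau>'. step {w. S1 f \<noteq> 0 \<and> w < n \<and> 0 < ?E (S x * n + w)} (15 + 40 * D) S1 A1 S' A' \<tau>1 \<tau>' \<Longrightarrow> R S' A' \<tau>'"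
    for f x R S1 A1 \<tau>1
  proof -
    have x: "S x < n" "S1 x = S x" "S1 ''n'' = n" using that(1,2) r uv by (auto simp: regs_def)
    from that(5) obtain ex c where A1: "A1 = A(''excluded'' := ex, ''c'' := c)" by blast
    have A1': "A1 ''E'' = A ''E''" "A1 ''len'' = A ''len''" unfolding A1 by simp_all
    have D1: "\<forall>x<n. A1 ''heavy'' x = 0 \<longrightarrow> A1 ''len'' x \<le> D" using D unfolding A1 by simp
    have b1: "base n A1" using base unfolding A1 by simp
    have sy1: "adj_sym n (A1 ''E'')" using sym unfolding A1 by simp
    show ?thesis
      apply (intro wp_intros)
      subgoal using that(4) by simp
      subgoal using x by simp
      subgoal
        apply (rule wp_fix[OF b1 that(6) sy1 _ _ D1])
        subgoal using x by simp
        subgoal using x by simp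
        subgoal premises prems for p q r s ex' c' A2 \<tau>2
        proof (rule that(7))
          have "A ''len'' (S x) \<le> D" using that(3) prems(1) by simp
          with prems(5) x have "\<tau>2 + low_out n A2 * ?K \<le> \<tau>1 + (15 + 40 * D) + low_out n A1 * ?K"
            by (simp add: A1')
          moreover have "\<exists>ex c. A2 = A1(''excluded'' := ex, ''c'' := c)" using prems(2) by blast
          ultimately show "step {w. S1 f \<noteq> 0 \<and> w < n \<and> 0 < ?E (S x * n + w)} (15 + 40 * D) S1 A1
              (S1(''a'' := val \<lparr>scalar = S1, arr = A1\<rparr> (Var x), ''j'' := p, ''x'' := q, ''i'' := r, ''y'' := s)) A2 \<tau>1 \<tau>2"
            using prems(3,4) x unfolding step_def by (auto simp: regs_def A1')
        qed
        done
      subgoal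
        apply (rule that(7))
        using that(6) same[of A1] unfolding step_def by auto
      done
  qed
  have enter_step: "wp W (Assign ''x'' (Var x) ;; enter) R S1 A1 \<tau>1"
    if "regs S1 = regs S" "x = ''u'' \<or> x = ''v''"
      "\<exists>ex c. A1 = A(''excluded'' := ex, ''c'' := c)" "dyn n A1"
      "\<And>S' A' \<tau>'. step {S x} 25 S1 A1 S' A' \<tau>1 \<tau>' \<Longrightarrow> R S' A' \<tau>'"
    for x R S1 A1 \<tau>1
  proof -
    have x: "S x < n" "S1 x = S x" "S1 ''n'' = n" using that(1,2) r uv by (auto simp: regs_def)
    from that(3) obtain ex c where A1: "A1 = A(''excluded'' := ex, ''c'' := c)" by blast
    have A1': "A1 ''E'' = A ''E''" "A1 ''len'' = A ''len''" unfolding A1 by simp_all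
    have D1: "\<forall>x<n. A1 ''heavy'' x = 0 \<longrightarrow> A1 ''len'' x \<le> D" using D unfolding A1 by simp
    have b1: "base n A1" using base unfolding A1 by simp
    have sy1: "adj_sym n (A1 ''E'')" using sym unfolding A1 by simp
    show ?thesis
      apply (intro wp_intros)
      subgoal using x by simp
      apply (rule wp_enter[OF b1 that(4) sy1 _ _ D1])
      subgoal using x by simp
      subgoal using x by simp
      subgoal for p q ex' c' A2 \<tau>2
        apply (rule that(5))
        using x unfolding step_def
        by (simp add: regs_def; blast)
      done
  qed
  show ?thesis
    unfolding fix_phase_def
    apply (rule wp_Seq)
    apply (rule fix_step)
    subgoal by simp
    subgoal by simp
    subgoal using fu r by (simp add: regs_def)
    subgoal by (rule f)
    subgoal by (rule same)
    subgoal by (rule dyn)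
    subgoal premises 1 for S1 A1 \<tau>1
      apply (rule wp_Seq)
      apply (rule fix_step)
      subgoal using 1 by (simp add: step_def)
      subgoal by simp
      subgoal using fv r 1 by (simp add: step_def regs_def)
      subgoal using f 1 by (simp add: step_def)
      subgoal using 1 by (simp add: step_def)
      subgoal using 1 by (simp add: step_def)
      subgoal premises 2 for S2 A2 \<tau>2
        apply (rule wp_Seq)
        apply (rule enter_step)
        subgoal using step_trans[OF 1 2] by (simp add: step_def)
        subgoal by simp
        subgoal using step_trans[OF 1 2] by (simp add: step_def)
        subgoal using 2 by (simp add: step_def)
        subgoal premises 3 for S3 A3 \<tau>3
          apply (rule enter_step)
          subgoal using step_trans[OF step_trans[OF 1 2] 3] by (simp add: step_def)
          subgoal by simp
          subgoal using step_trans[OF step_trans[OF 1 2] 3] by (simp add: step_def)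
          subgoal using 3 by (simp add: step_def)
          subgoal premises 4 for S4 A4 \<tau>4
          proof -
            note s = step_trans[OF step_trans[OF step_trans[OF 1 2] 3] 4]
            obtain ex c where A4: "A4 = A(''excluded'' := ex, ''c'' := c)"
              using s unfolding step_def by blast
            have "S1 ''fv'' = S ''fv''" using 1 by (simp add: step_def)
            with s sus r have "suspects n A4 = {}" unfolding step_def regs_def by auto
            with s show ?thesis by (intro Q[OF _ _ A4]) (auto simp: step_def)
          qed
          done
        done
      done
    done
qed

end

section \<open>The invariant\<close>

text \<open>On the diagonal 0 is demanded, not merely the absence of a loop: a value 1 would put a
  vertex on its own list.\<close>

definition graph_ok :: "nat \<Rightarrow> (nat \<Rightarrow> nat) \<Rightarrow> edge set \<Rightarrow> bool" where
  "graph_ok n E G \<longleftrightarrow> (\<forall>a<n. \<forall>b<n. 1 < E (a * n + b) \<longleftrightarrow> {a, b} \<in> G) \<and>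
     (\<forall>a<n. E (a * n + a) = 0) \<and> (\<forall>e\<in>G. \<exists>a b. a < n \<and> b < n \<and> a \<noteq> b \<and> e = {a, b})"

lemma graph_ok_sym: "graph_ok n E G \<Longrightarrow> adj_sym n E"
  unfolding graph_ok_def adj_sym_def by (metis insert_commute)

lemma graph_ok_finite: "graph_ok n E G \<Longrightarrow> finite G"
  by (rule finite_subset[of _ "Pow {..<n}"]) (auto simp: graph_ok_def)

lemma graph_ok_update:
  assumes G: "graph_ok n E G" and uv: "u < n" "v < n" "u \<noteq> v"
  shows "graph_ok n (E(u * n + v := 2, v * n + u := 2)) (insert {u, v} G)"
    and "graph_ok n (E(u * n + v := 1, v * n + u := 1)) (G - {{u, v}})"
  using assms unfolding graph_ok_def by (auto simp: cell_eq_iff doubleton_eq_iff)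

lemma induced_edges_le_arboricity:
  assumes "finite V" "arboricity V E \<le> lam" "U \<subseteq> V" "2 \<le> card U"
  shows "card (induced_edges E U) \<le> lam * (card U - 1)"
proof -
  let ?f = "\<lambda>U. nat \<lceil>real (card (induced_edges E U)) / (real (card U) - 1)\<rceil>"
  \<comment> \<open>A supremum on \<open>nat\<close> is an upper bound only for bounded sets;
    finiteness of \<open>V\<close> supplies this.\<close>
  have "finite {U. U \<subseteq> V \<and> 2 \<le> card U}" using assms(1) by simp
  then have "?f U \<le> (SUP U\<in>{U. U \<subseteq> V \<and> 2 \<le> card U}. ?f U)"
    using assms(3,4) by (intro cSUP_upper) auto
  with assms(2) have "?f U \<le> lam" unfolding arboricity_def by linarith
  then have "real (card (induced_edges E U)) / (real (card U) - 1) \<le> real lam" by linarith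
  then have "real (card (induced_edges E U)) \<le> real lam * (real (card U) - 1)"
    using assms(4) by (simp add: pos_divide_le_eq)
  also have "\<dots> = real (lam * (card U - 1))" using assms(4) by (simp add: of_nat_diff)
  finally show ?thesis by (simp only: of_nat_le_iff)
qed

lemma rows_ok_length:
  assumes "rows_ok n E H hn row rlen {}" "i < hn"
  shows "rlen (H i) = card {k. k < i \<and> 1 < E (H i * n + H k)}"
proof -
  have "length (map (\<lambda>j. row (H i * n + j)) [0..<rlen (H i)]) =
      length (filter (\<lambda>y. 1 < E (H i * n + y)) (map H [0..<i]))"
    using assms unfolding rows_ok_def by simp
  also have "\<dots> = card {k. k < length (map H [0..<i]) \<and> 1 < E (H i * n + map H [0..<i] ! k)}"
    by (rule length_filter_conv_card)
  also have "\<dots> = card {k. k < i \<and> 1 < E (H i * n + H k)}"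
    by (rule arg_cong[where f = card]) auto
  finally show ?thesis by simp
qed

text \<open>An edge between heavy vertices is listed in the row of its later endpoint only; the
  order \<open>k < i\<close> excludes a second occurrence with the roles exchanged. So the rows
  inject into the edges induced by the heavy vertices. With fewer than two of these the arboricity
  says nothing, but then all rows are empty.\<close>

lemma rows_sum_le:
  assumes G: "graph_ok n E G" and H: "heavies_ok n hv H hn" and R: "rows_ok n E H hn row rlen {}"
    and arb: "arboricity {..<n} G \<le> lam"
  shows "(\<Sum>i<hn. rlen (H i)) \<le> lam * hn"
proof -
  let ?R = "\<lambda>i. {k. k < i \<and> 1 < E (H i * n + H k)}" and ?U = "H ` {..<hn}"
  have inj: "inj_on H {..<hn}"
    using H unfolding heavies_ok_def inj_on_def by (metis lessThan_iff nat.inject)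
  have Hn: "H i < n" if "i < hn" for i using H that unfolding heavies_ok_def by blast
  have card_U: "card ?U = hn" using inj by (simp add: card_image)
  have sum: "(\<Sum>i<hn. rlen (H i)) = (\<Sum>i<hn. card (?R i))"
    using rows_ok_length[OF R] by simp
  also have "\<dots> = card (Sigma {..<hn} ?R)" by simp
  also have "\<dots> \<le> card (induced_edges G ?U)"
  proof (rule card_inj_on_le)
    show "inj_on (\<lambda>(i, k). {H i, H k}) (Sigma {..<hn} ?R)"
    proof (rule inj_onI, clarsimp)
      fix i k i' k' assume *: "i < hn" "i' < hn" "k < i" "k' < i'" "{H i, H k} = {H i', H k'}"
      then have "H i = H i' \<and> H k = H k' \<or> H i = H k' \<and> H k = H i'" by (simp add: doubleton_eq_iff)
      with * inj have "i = i' \<and> k = k' \<or> i = k' \<and> k = i'"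
        unfolding inj_on_def by (metis lessThan_iff less_trans)
      with * show "i = i' \<and> k = k'" by auto
    qed
    show "(\<lambda>(i, k). {H i, H k}) ` Sigma {..<hn} ?R \<subseteq> induced_edges G ?U"
      using G Hn by (auto simp: induced_edges_def graph_ok_def)
    show "finite (induced_edges G ?U)" using graph_ok_finite[OF G] by (simp add: induced_edges_def)
  qed
  finally have le: "(\<Sum>i<hn. rlen (H i)) \<le> card (induced_edges G ?U)" .
  show ?thesis
  proof (cases "2 \<le> hn")
    case True
    have "card (induced_edges G ?U) \<le> lam * (card ?U - 1)"
      by (rule induced_edges_le_arboricity[OF _ arb]) (use Hn card_U True in auto)
    also have "\<dots> \<le> lam * hn" by (intro mult_le_mono) (simp_all add: card_U)
    finally show ?thesis using le by simp
  next
    case False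
    then have "?R i = {}" if "i < hn" for i using that by auto
    then have "(\<Sum>i<hn. card (?R i)) = 0" by simp
    with sum have "(\<Sum>i<hn. rlen (H i)) = 0" by (simp only:)
    then show ?thesis by (simp only: le0)
  qed
qed

lemma rows_ok_scan:
  assumes hv: "heavies_ok n hv H hn" and rows: "rows_ok n E H hn row rlen Z" and a: "a < n"
    and row': "\<And>x j. x \<noteq> a \<Longrightarrow> j < n \<Longrightarrow> row' (x * n + j) = row (x * n + j)"
    and rlen': "\<And>x. x \<noteq> a \<Longrightarrow> rlen' x = rlen x"
    and new: "map (\<lambda>j. row' (a * n + j)) [0..<rlen' a] = filter (\<lambda>y. 1 < E (a * n + y)) (map H [0..<hv a - 1])"
  shows "rows_ok n E H hn row' rlen' (Z - {a})"
  unfolding rows_ok_def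
proof (intro allI impI)
  fix i assume i: "i < hn" "H i \<notin> Z - {a}"
  show "map (\<lambda>j. row' (H i * n + j)) [0..<rlen' (H i)] = filter (\<lambda>y. 1 < E (H i * n + y)) (map H [0..<i])"
  proof (cases "H i = a")
    case True
    then have "hv a = Suc i" using hv i unfolding heavies_ok_def by blast
    with new True show ?thesis by simp
  next
    case False
    have old: "map (\<lambda>j. row (H i * n + j)) [0..<rlen (H i)] = filter (\<lambda>y. 1 < E (H i * n + y)) (map H [0..<i])"
      using rows i False unfolding rows_ok_def by blast
    have "length (map (\<lambda>j. row (H i * n + j)) [0..<rlen (H i)]) \<le> length (map H [0..<i])"
      unfolding old by (rule length_filter_le)
    then have "rlen (H i) \<le> n" using i heavies_ok_le[OF hv] by simp
    then have "map (\<lambda>j. row' (H i * n + j)) [0..<rlen' (H i)] = map (\<lambda>j. row (H i * n + j)) [0..<rlen (H i)]"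
      using row' rlen' False by (intro map_cong) auto
    with old show ?thesis by simp
  qed
qed

lemma rows_ok_mono: "rows_ok n E H hn row rlen Y \<Longrightarrow> Y \<subseteq> Z \<Longrightarrow> rows_ok n E H hn row rlen Z"
  unfolding rows_ok_def by blast

text \<open>A recursion along \<open>H\<close> that determines the heavy flags: the
  lexicographically first extension of the low set. One direction of the equivalence gives
  independence, the other domination.\<close>

definition greedy_ok ::
  "nat \<Rightarrow> (nat \<Rightarrow> nat) \<Rightarrow> (nat \<Rightarrow> nat) \<Rightarrow> nat \<Rightarrow> (nat \<Rightarrow> nat) \<Rightarrow> (nat \<Rightarrow> nat) \<Rightarrow> bool" where
  "greedy_ok n E H hn c ex \<longleftrightarrow> (\<forall>i<hn. ex (H i) = 0 \<longleftrightarrow> c (H i) = 0 \<and>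
     (\<forall>k<i. 1 < E (H i * n + H k) \<longrightarrow> ex (H k) \<noteq> 0))"

context word_size
begin

text \<open>Each scan removes its endpoint from the exempted set. The coefficient 140 consists of 50
  for either scan and 40 for the greedy loop.\<close>

lemma wp_heavy_phase:
  assumes base: "base n A" and dyn: "dyn n A" and hv: "heavies_ok n (A ''heavy'') (A ''H'') (S ''hn'')"
    and rows: "rows_ok n (A ''E'') (A ''H'') (S ''hn'') (A ''row'') (A ''rlen'') {u, v}"
    and r: "regs S = (n, lam, ins, u, v, t)" and uv: "u < n" "v < n"
    and Q: "\<And>S' row rlen ex A' \<tau>'. regs S' = regs S \<Longrightarrow> S' ''hn'' = S ''hn'' \<Longrightarrow>
      A' = A(''row'' := row, ''rlen'' := rlen, ''excluded'' := ex) \<Longrightarrow>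
      rows_ok n (A ''E'') (A ''H'') (S ''hn'') row rlen {} \<Longrightarrow>
      (\<And>y. y < n \<Longrightarrow> A ''heavy'' y = 0 \<Longrightarrow> ex y = A ''excluded'' y) \<Longrightarrow> (\<And>y. y < n \<Longrightarrow> ex y \<le> 1) \<Longrightarrow>
      greedy_ok n (A ''E'') (A ''H'') (S ''hn'') (A ''c'') ex \<Longrightarrow>
      \<tau>' \<le> \<tau> + 50 + 140 * S ''hn'' + 30 * (\<Sum>i<S ''hn''. rlen (A ''H'' i)) \<Longrightarrow>
      Q S' A' \<tau>'"
  shows "wp W heavy_phase Q S A \<tau>"
proof -
  have frame: "base n (A(''row'' := row, ''rlen'' := rlen))" "dyn n (A(''row'' := row, ''rlen'' := rlen))" for row rlen
    using base dyn by (simp_all add: base_def dyn_def)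
  show ?thesis
    unfolding heavy_phase_def
    apply (intro wp_intros)
    subgoal using uv r by (simp add: regs_def)
    apply (rule wp_scan_row)
    subgoal by (rule base)
    subgoal using hv by simp
    subgoal using r by (simp add: regs_def)
    subgoal using uv r by (simp add: regs_def)
    subgoal premises 1 for p q r1 row1 rlen1 \<tau>1
      apply (intro wp_intros)
      subgoal using uv r by (simp add: regs_def)
      apply (rule wp_scan_row)
      subgoal by (rule frame)
      subgoal using hv by simp
      subgoal using r by (simp add: regs_def)
      subgoal using uv r by (simp add: regs_def)
      subgoal premises 2 for p2 q2 r2 row2 rlen2 \<tau>2
      proof -
        have u: "S ''u'' = u" "S ''v'' = v" "S ''n'' = n" using r by (simp_all add: regs_def)
        note 1 = 1[simplified, simplified u]
        note 2 = 2[simplified, simplified u]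
        have rows1: "rows_ok n (A ''E'') (A ''H'') (S ''hn'') row1 rlen1 ({u, v} - {u})"
          by (rule rows_ok_scan[OF hv rows uv(1)]) (use 1 in simp_all)
        have rows2: "rows_ok n (A ''E'') (A ''H'') (S ''hn'') row2 rlen2 ({u, v} - {u} - {v})"
          by (rule rows_ok_scan[OF hv rows1 uv(2)]) (use 2 in simp_all)
        then have rows2: "rows_ok n (A ''E'') (A ''H'') (S ''hn'') row2 rlen2 {}"
          by (rule rows_ok_mono) auto
        have A2: "A(''row'' := row1, ''rlen'' := rlen1, ''row'' := row2, ''rlen'' := rlen2)
            = A(''row'' := row2, ''rlen'' := rlen2)"
          by (auto simp: fun_eq_iff)
        show ?thesis unfolding A2
          apply (rule wp_greedy)
          subgoal by (rule frame)
          subgoal by (rule frame)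
          subgoal using u by simp
          subgoal using hv by simp
          subgoal using rows2 by simp
          subgoal premises 3 for p3 q3 r3 s3 ex \<tau>3
          proof (rule Q)
            show "A(''row'' := row2, ''rlen'' := rlen2, ''excluded'' := ex) =
              A(''row'' := row2, ''rlen'' := rlen2, ''excluded'' := ex)" by (rule refl)
            show "greedy_ok n (A ''E'') (A ''H'') (S ''hn'') (A ''c'') ex"
              unfolding greedy_ok_def 
            proof (intro allI impI)
              fix i assume "i < S ''hn''"
              with 3(3)[of i] show "ex (A ''H'' i) = 0 \<longleftrightarrow> A ''c'' (A ''H'' i) = 0 \<and>
                  (\<forall>k<i. 1 < A ''E'' (A ''H'' i * n + A ''H'' k) \<longrightarrow> ex (A ''H'' k) \<noteq> 0)" by simp
            qed
          qed (use 1 2 3 rows2 in \<open>simp_all add: regs_def\<close>)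
          done
      qed
      done
    done
qed

definition invariant :: "nat \<Rightarrow> edge set \<Rightarrow> (vname \<Rightarrow> nat) \<Rightarrow> (vname \<Rightarrow> nat \<Rightarrow> nat) \<Rightarrow> bool" where
  "invariant t G S A \<longleftrightarrow> S ''n'' = n \<and> S ''lambda'' = lam \<and> S ''t'' = t \<and>
     base n A \<and> dyn n A \<and> suspects n A = {} \<and> graph_ok n (A ''E'') G \<and>
     heavies_ok n (A ''heavy'') (A ''H'') (S ''hn'') \<and>
     rows_ok n (A ''E'') (A ''H'') (S ''hn'') (A ''row'') (A ''rlen'') {} \<and>
     greedy_ok n (A ''E'') (A ''H'') (S ''hn'') (A ''c'') (A ''excluded'') \<and>
     (\<forall>x<n. A ''heavy'' x = 0 \<longrightarrow> (A ''len'' x)\<^sup>2 \<le> lam * t) \<and>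
     few_heavy lam t (S ''hn'') (mass n (A ''heavy'') (A ''len''))"

text \<open>Zeroed memory already represents the empty graph with every vertex low and in the set.
  Therefore \<open>Skip\<close> can serve as initialisation, at a cost independent of
  \<open>n\<close>.\<close>

lemma invariant_start: "invariant 0 {} (scalar (start_state n lam)) (arr (start_state n lam))"
  unfolding invariant_def start_state_def
  by (auto simp: base_def dyn_def suspects_def graph_ok_def heavies_ok_def rows_ok_def greedy_ok_def
      lists_ok_def count_ok_def few_heavy_def mass_def bij_betw_def)

text \<open>All members, low or heavy, have counter 0, which excludes edges from a low member to any
  member; an edge between heavy members would contradict the greedy rule at the later one. An
  excluded vertex with positive counter has a low member as neighbour. With counter 0 it must be
  heavy, as there are no suspects, and then an earlier heavy member blocked it.\<close>

lemma invariant_mis: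
  assumes inv: "invariant t G S A"
  shows "maximal_independent_set {..<n} G {v. v < n \<and> A ''excluded'' v = 0}"
proof -
  let ?E = "A ''E''" and ?ex = "A ''excluded''" and ?c = "A ''c''" and ?hv = "A ''heavy''" and ?H = "A ''H''"
  let ?I = "{v. v < n \<and> ?ex v = 0}"
  note inv = inv[unfolded invariant_def]
  have edge: "1 < ?E (a * n + b) \<longleftrightarrow> {a, b} \<in> G" if "a < n" "b < n" for a b
    using inv that unfolding graph_ok_def by blast
  have c: "?c w = card {x. x < n \<and> ?hv x = 0 \<and> ?ex x = 0 \<and> {x, w} \<in> G}" if "w < n" for w
  proof -
    have "{x. x < n \<and> ?hv x = 0 \<and> ?ex x = 0 \<and> 1 < ?E (x * n + w)}
        = {x. x < n \<and> ?hv x = 0 \<and> ?ex x = 0 \<and> {x, w} \<in> G}"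
      using edge that by blast
    then show ?thesis using inv that unfolding dyn_def count_ok_def by simp
  qed
  then have c0: "?c w = 0 \<longleftrightarrow> (\<forall>x<n. ?hv x = 0 \<longrightarrow> ?ex x = 0 \<longrightarrow> {x, w} \<notin> G)" if "w < n" for w
    using that by auto
  have low: "?ex x = 0 \<longleftrightarrow> ?c x = 0" if "x < n" "?hv x = 0" for x
  proof -
    have "x \<notin> suspects n A" using inv by simp
    moreover have "?ex x = 0 \<Longrightarrow> ?c x = 0" using inv that unfolding dyn_def by blast
    ultimately show ?thesis using that by (auto simp: suspects_def)
  qed
  have H: "?H i < n" "?hv (?H i) = Suc i" if "i < S ''hn''" for i
    using inv that unfolding heavies_ok_def by auto
  have heavy: "\<exists>i<S ''hn''. x = ?H i" if "x < n" "?hv x \<noteq> 0" for x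
  proof -
    have "?hv x \<le> S ''hn'' \<and> ?H (?hv x - 1) = x" using inv that unfolding heavies_ok_def by blast
    then show ?thesis using that(2) by (intro exI[of _ "?hv x - 1"]) auto
  qed
  have greedy: "?ex (?H i) = 0 \<longleftrightarrow> ?c (?H i) = 0 \<and> (\<forall>k<i. {?H i, ?H k} \<in> G \<longrightarrow> ?ex (?H k) \<noteq> 0)"
    if i: "i < S ''hn''" for i
  proof -
    have "1 < ?E (?H i * n + ?H k) \<longleftrightarrow> {?H i, ?H k} \<in> G" if "k < i" for k
      using edge H(1) that i by simp
    moreover have "?ex (?H i) = 0 \<longleftrightarrow> ?c (?H i) = 0 \<and> (\<forall>k<i. 1 < ?E (?H i * n + ?H k) \<longrightarrow> ?ex (?H k) \<noteq> 0)"
      using inv i unfolding greedy_ok_def by blast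
    ultimately show ?thesis by auto
  qed
  have irr: "{x} \<notin> G" if "x < n" for x using edge[OF that that] inv that unfolding graph_ok_def by simp
  have cz: "?c x = 0" if "x < n" "?ex x = 0" for x
    using low[OF that(1)] greedy heavy[OF that(1)] that(2) by metis
  have indep: "{x, y} \<notin> G" if xy: "x < n" "y < n" "?ex x = 0" "?ex y = 0" for x y
  proof
    assume G: "{x, y} \<in> G"
    then have "?hv x \<noteq> 0" "?hv y \<noteq> 0"
      using c0[of y] c0[of x] cz xy by (auto simp: insert_commute)
    with heavy xy obtain i k where i: "i < S ''hn''" "x = ?H i" and k: "k < S ''hn''" "y = ?H k" by metis
    have "i \<noteq> k" using G irr xy i k by auto
    then consider "i < k" | "k < i" by linarith
    then show False
      using greedy[OF i(1)] greedy[OF k(1)] i k G xy by cases (auto simp: insert_commute)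
  qed
  have dom: "\<exists>y<n. ?ex y = 0 \<and> {x, y} \<in> G" if x: "x < n" "?ex x \<noteq> 0" for x
  proof (cases "?c x = 0")
    case False
    then show ?thesis using c0[OF x(1)] by (auto simp: insert_commute)
  next
    case True
    then have "?hv x \<noteq> 0" using low[OF x(1)] x(2) True by auto
    from heavy[OF x(1) this] obtain i where i: "i < S ''hn''" "x = ?H i" by blast
    then obtain k where "k < i" "{x, ?H k} \<in> G" "?ex (?H k) = 0"
      using greedy[OF i(1)] x(2) True by auto
    then show ?thesis using H(1)[of k] i by auto
  qed
  show ?thesis
    unfolding maximal_independent_set_def independent_set_def
  proof (intro conjI allI impI)
    fix J assume J: "(J \<subseteq> {..<n} \<and> (\<forall>u\<in>J. \<forall>v\<in>J. {u, v} \<notin> G)) \<and> ?I \<subseteq> J"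
    show "J = ?I"
    proof (intro equalityI subsetI)
      fix x assume x: "x \<in> J"
      show "x \<in> ?I"
      proof (rule ccontr)
        assume "x \<notin> ?I"
        with x J have "x < n" "?ex x \<noteq> 0" by auto
        from dom[OF this] obtain y where "y \<in> ?I" "{x, y} \<in> G" by blast
        with x J show False by blast
      qed
    qed (use J in blast)
  qed (use indep in auto)
qed

text \<open>\<open>low_out n A\<close> is the potential: detaching raises it by at most 2, and each vertex that enters pays for
  the scan of its list by lowering it.\<close>

lemma wp_mis_update:
  assumes inv: "invariant t G S0 A" and ins: "ins \<le> 1" and uv: "u < n" "v < n" "u \<noteq> v"
    and S: "S = S0(''insert'' := ins, ''u'' := u, ''v'' := v)"
    and G': "G' = (if ins = 1 then insert {u, v} G else G - {{u, v}})"
    and t: "t < m" and arb: "arboricity {..<n} G' \<le> lam" and D: "\<And>x. x\<^sup>2 \<le> lam * m \<Longrightarrow> x \<le> D"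
    and Q: "\<And>S' A' \<tau>'. invariant (Suc t) G' S' A' \<Longrightarrow>
       \<tau>' + low_out n A' * (31 * D + 51) \<le>
         \<tau> + low_out n A * (31 * D + 51) + 800 + 210 * D + 140 * S' ''hn'' + 30 * (lam * S' ''hn'') \<Longrightarrow> Q S' A' \<tau>'"
  shows "wp W mis_update Q S A \<tau>"
proof -
  let ?E = "A ''E''" and ?hv = "A ''heavy''" and ?len = "A ''len''" and ?H = "A ''H''"
  define E' where "E' = ?E(u * n + v := Suc ins, v * n + u := Suc ins)"
  define S1 where "S1 = S(''t'' := Suc t)"
  note inv = inv[unfolded invariant_def]
  have base: "base n A" and dyn: "dyn n A" and sus0: "suspects n A = {}" and graph: "graph_ok n ?E G"
    and hok: "heavies_ok n ?hv ?H (S0 ''hn'')"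
    and rows: "rows_ok n ?E ?H (S0 ''hn'') (A ''row'') (A ''rlen'') {}"
    and short: "\<And>x. x < n \<Longrightarrow> ?hv x = 0 \<Longrightarrow> (?len x)\<^sup>2 \<le> lam * t"
    and few: "few_heavy lam t (S0 ''hn'') (mass n ?hv ?len)"
    using inv by blast+
  have lenD: "?len x \<le> D" if "x < n" "?hv x = 0" for x
    using D[OF order_trans[OF short[OF that]]] t by simp
  have irr: "?E (a * n + a) = 0" if "a < n" for a using graph that by (simp add: graph_ok_def)
  have regs: "regs S1 = (n, lam, ins, u, v, Suc t)" using inv by (simp add: S1_def S regs_def)
  have hn: "S1 ''hn'' = S0 ''hn''" by (simp add: S1_def S)
  have graph': "graph_ok n E' G'"
  proof (cases "ins = 1")
    case True
    then show ?thesis using graph_ok_update(1)[OF graph uv] by (simp add: E'_def G' numeral_2_eq_2)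
  next
    case False
    with ins have "ins = 0" by simp
    then show ?thesis using graph_ok_update(2)[OF graph uv] by (simp add: E'_def G')
  qed
  have E'_other: "E' (x * n + w) = ?E (x * n + w)" if "x \<notin> {u, v}" "w < n" for x w
    using that uv by (simp add: E'_def cell_eq_iff)
  \<comment> \<open>A deleted edge keeps the value 1, so a former neighbour is still on the list and
    will be reached by the repair.\<close>
  have E'_pos: "0 < E' (x * n + w)" if "1 < ?E (x * n + w)" for x w
    using that by (simp add: E'_def)
  \<comment> \<open>Supplies the assumption of \<open>few_heavy_Suc\<close> for the first
    update.\<close>
  have mass0: "mass n ?hv ?len = 0" if "t = 0"
    using short that by (simp add: mass_def)
  show ?thesis
    unfolding mis_update_def
  proof (intro wp_Seq wp_Assign, goal_cases)
    case 1
    then show ?case using inv t by (simp add: S)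
  next
    case 2
    have S1: "S(''t'' := val \<lparr>scalar = S, arr = A\<rparr> (Op Add (Var ''t'') (Const 1))) = S1"
      using inv by (simp add: S1_def S)
    show ?case unfolding S1
    proof (rule wp_detach_phase[OF base dyn regs uv sus0 lenD], assumption, assumption, rule wp_Seq)
      fix S2 ex1 c1 A1 \<tau>1
      assume regs2: "regs S2 = regs S1" "S2 ''hn'' = S1 ''hn''"
        and A1: "A1 = A(''excluded'' := ex1, ''c'' := c1)" and dyn1: "dyn n A1"
        and sus1: "suspects n A1 \<subseteq> {w. \<exists>x\<in>{u, v}. ?hv x = 0 \<and> (w = x \<or> w < n \<and> 1 < ?E (x * n + w))}"
        and out: "\<And>x. x \<in> {u, v} \<Longrightarrow> ?hv x = 0 \<Longrightarrow> ex1 x \<noteq> 0"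
        and lo1: "low_out n A1 \<le> low_out n A + 2"
        and t1: "\<tau>1 \<le> \<tau> + (cost (Op Add (Var ''t'') (Const 1)) + 1) + 50 + 62 * D"
      have base1: "base n A1" using base by (simp add: A1)
      have A1_simps: "A1 ''E'' = ?E" "A1 ''heavy'' = ?hv" "A1 ''len'' = ?len" "A1 ''H'' = ?H"
         "A1 ''row'' = A ''row''" "A1 ''rlen'' = A ''rlen''" "A1 ''excluded'' = ex1" "A1 ''c'' = c1" by (simp_all add: A1)
      show "wp W link_phase (wp W (promote_phase ;; fix_phase ;; heavy_phase) Q) S2 A1 \<tau>1"
      proof (rule wp_link_phase[OF base1 regs2(1)[unfolded regs] ins uv], unfold A1_simps, rule irr, assumption, rule wp_Seq)
        fix S3 L' len' A2 \<tau>2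
        assume regs3: "regs S3 = regs S2" "S3 ''hn'' = S2 ''hn''"
          and A2: "A2 = A1(''L'' := L', ''len'' := len', ''E'' := ?E(u * n + v := Suc ins, v * n + u := Suc ins))"
          and base2: "base n A2" and len': "\<And>y. y \<noteq> u \<Longrightarrow> y \<noteq> v \<Longrightarrow> len' y = ?len y"
            "len' u \<le> ?len u + 1" "len' v \<le> ?len v + 1"
          and t2: "\<tau>2 \<le> \<tau>1 + 100"
        have A2_simps: "A2 ''E'' = E'" "A2 ''heavy'' = ?hv" "A2 ''len'' = len'" "A2 ''H'' = ?H"
          "A2 ''row'' = A ''row''" "A2 ''rlen'' = A ''rlen''" "A2 ''excluded'' = ex1" "A2 ''c'' = c1"
          by (simp_all add: A2 A1_simps E'_def)
        have regs3': "regs S3 = (n, lam, ins, u, v, Suc t)" using regs3 regs2 regs by simp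
        have hn3: "S3 ''hn'' = S0 ''hn''" using regs3 regs2 hn by simp
        have few2: "few_heavy lam (Suc t) (S0 ''hn'') (mass n ?hv len')"
          using few_heavy_Suc[OF few mass_link[OF len' uv(3)] mass0] .
        show "wp W promote_phase (wp W (fix_phase ;; heavy_phase) Q) S3 A2 \<tau>2"
        proof (rule wp_promote_phase[OF base2 _ _ regs3' _ _ uv(1,2)], unfold A2_simps hn3, rule hok, rule few2,
            simp, use t in simp, rule wp_Seq)
          fix S4 A3 \<tau>3
          assume regs4: "regs S4 = regs S3" and prom: "promoted {u, v} (Suc t) A2 (S0 ''hn'') A3 (S4 ''hn'')"
            and fu: "S4 ''fu'' = 0 \<longleftrightarrow> ?hv u \<noteq> 0" "S4 ''fv'' = 0 \<longleftrightarrow> ?hv v \<noteq> 0" "S4 ''fu'' \<le> 1" "S4 ''fv'' \<le> 1"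
            and t3: "\<tau>3 \<le> \<tau>2 + 100"
          let ?H3 = "A3 ''H''" and ?hv3 = "A3 ''heavy''" and ?hn3 = "S4 ''hn''"
          note prom = prom[unfolded promoted_def]
          have A3: "A3 = A2(''H'' := ?H3, ''heavy'' := ?hv3)" using prom by blast
          have A3_simps: "A3 ''E'' = E'" "A3 ''len'' = len'"
            "A3 ''row'' = A ''row''" "A3 ''rlen'' = A ''rlen''" "A3 ''excluded'' = ex1" "A3 ''c'' = c1"
            by (subst A3, simp add: A2_simps)+
          have base3: "base n A3" and hok3: "heavies_ok n ?hv3 ?H3 ?hn3"
            and few3: "few_heavy lam (Suc t) ?hn3 (mass n ?hv3 len')"
            using prom by (auto simp: A3_simps)
          have hv3: "?hv3 y = ?hv y" if "y \<notin> {u, v} \<or> 0 < ?hv y" for y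
            using prom that unfolding A2_simps by blast
          then have hv3_0: "?hv y = 0" if "?hv3 y = 0" for y using that by (metis gr0I)
          have H3: "?H3 i = ?H i" if "i < S0 ''hn''" for i using prom that unfolding A2_simps by blast
          have H3_new: "i < S0 ''hn''" if "i < ?hn3" "?H3 i \<notin> {u, v}" for i
            using prom that by (meson linorder_not_le)
          \<comment> \<open>The endpoints were tested by \<open>promote\<close>. No other list has
            grown, while the threshold has.\<close>
          have short3: "(len' x)\<^sup>2 \<le> lam * Suc t" if "x < n" "?hv3 x = 0" for x
          proof (cases "x \<in> {u, v}")
            case True
            then show ?thesis using prom that unfolding A3_simps by blast
          next
            case False
            then have "(len' x)\<^sup>2 \<le> lam * t" using short[OF that(1) hv3_0[OF that(2)]] len' by simp
            then show ?thesis by simp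
          qed
          \<comment> \<open>An update adds at most one entry to a list, whence \<open>D + 1\<close>.
            The bound covers the vertices that were low before the promotions.\<close>
          have len3: "len' x \<le> D + 1" if "x < n" "?hv x = 0" for x
            using lenD[OF that] len'(1)[of x] len'(2,3) by (cases "x = u"; cases "x = v") auto
          \<comment> \<open>The sets counted by \<open>c\<close> are literally unchanged: an
            endpoint belongs to none of them, being heavy or already detached, and the rows of
            \<open>E\<close> of all other vertices are untouched.\<close>
          have dyn3: "dyn n A3"
          proof -
            have "{x. x < n \<and> ?hv3 x = 0 \<and> ex1 x = 0 \<and> 1 < E' (x * n + w)} =
                {x. x < n \<and> ?hv x = 0 \<and> ex1 x = 0 \<and> 1 < ?E (x * n + w)}" if "w < n" for w
            proof (rule Collect_cong)
              fix x
              show "x < n \<and> ?hv3 x = 0 \<and> ex1 x = 0 \<and> 1 < E' (x * n + w) \<longleftrightarrow>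
                  x < n \<and> ?hv x = 0 \<and> ex1 x = 0 \<and> 1 < ?E (x * n + w)"
              proof (cases "x \<in> {u, v}")
                case True
                from out[OF True] hv3_0[of x] show ?thesis by metis
              next
                case False
                then have "?hv3 x = ?hv x" "E' (x * n + w) = ?E (x * n + w)" using hv3 E'_other that by blast+
                then show ?thesis by simp
              qed
            qed
            with dyn1 have "count_ok n E' ?hv3 ex1 c1"
              unfolding dyn_def count_ok_def A1_simps by simp
            moreover have ind1: "c1 x = 0" if "x < n" "?hv x = 0" "ex1 x = 0" for x
              using dyn1 that unfolding dyn_def A1_simps by blast
            have "\<forall>x<n. ?hv3 x = 0 \<and> ex1 x = 0 \<longrightarrow> c1 x = 0" by (simp add: ind1 hv3_0)
            moreover have "\<forall>x<n. ex1 x \<le> 1" using dyn1 unfolding dyn_def A1_simps by blast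
            ultimately show ?thesis unfolding dyn_def A3_simps by (intro conjI)
          qed
          have sus3: "suspects n A3 \<subseteq> suspects n A1"
            using hv3_0 unfolding suspects_def A3_simps A1_simps by auto
          have lo3: "low_out n A3 \<le> low_out n A1"
            unfolding low_out_def A3_simps A1_simps
            by (rule card_mono) (use hv3_0 in auto)
          \<comment> \<open>A heavy vertex other than the endpoints has an old index. Its row
            depends on the part of \<open>H\<close> before it and on its own row of
            \<open>E\<close>, and neither has changed.\<close>
          have rows3: "rows_ok n E' ?H3 ?hn3 (A ''row'') (A ''rlen'') {u, v}"
            unfolding rows_ok_def
          proof (intro allI impI)
            fix i assume i: "i < ?hn3" "?H3 i \<notin> {u, v}"
            note i0 = H3_new[OF i]
            have m: "map ?H3 [0..<i] = map ?H [0..<i]" using H3 i0 by auto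
            have f: "filter (\<lambda>y. 1 < E' (?H3 i * n + y)) (map ?H [0..<i]) =
                filter (\<lambda>y. 1 < ?E (?H i * n + y)) (map ?H [0..<i])"
            proof (rule filter_cong)
              fix y assume "y \<in> set (map ?H [0..<i])"
              then have "y < n" using hok i0 unfolding heavies_ok_def by auto
              then show "1 < E' (?H3 i * n + y) \<longleftrightarrow> 1 < ?E (?H i * n + y)"
                using E'_other[of "?H3 i" y] i H3[OF i0] by simp
            qed simp
            have "map (\<lambda>j. A ''row'' (?H i * n + j)) [0..<A ''rlen'' (?H i)] =
                filter (\<lambda>y. 1 < ?E (?H i * n + y)) (map ?H [0..<i])"
              using rows i0 unfolding rows_ok_def by simp
            then show "map (\<lambda>j. A ''row'' (?H3 i * n + j)) [0..<A ''rlen'' (?H3 i)] =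
                filter (\<lambda>y. 1 < E' (?H3 i * n + y)) (map ?H3 [0..<i])"
              unfolding m f unfolding H3[OF i0] .
          qed
          have regs4': "regs S4 = (n, lam, ins, u, v, Suc t)" using regs4 regs3' by simp
          show "wp W fix_phase (wp W heavy_phase Q) S4 A3 \<tau>3"
          proof (rule wp_fix_phase[OF base3 dyn3 _ regs4' uv(1,2), where D = "D + 1"], unfold A3_simps)
            show "adj_sym n E'" by (rule graph_ok_sym[OF graph'])
            show "len' x \<le> D + 1" if "x < n" "?hv3 x = 0" for x using len3 hv3_0 that by blast
            show "S4 ''fu'' \<noteq> 0 \<Longrightarrow> len' u \<le> D + 1" "S4 ''fv'' \<noteq> 0 \<Longrightarrow> len' v \<le> D + 1"
              using fu len3 uv by auto
            show "S4 ''fu'' \<le> 1" "S4 ''fv'' \<le> 1" by (rule fu)+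
            show "suspects n A3 \<subseteq> {w. w = u \<or> w = v \<or> S4 ''fu'' \<noteq> 0 \<and> w < n \<and> 0 < E' (u * n + w) \<or>
                S4 ''fv'' \<noteq> 0 \<and> w < n \<and> 0 < E' (v * n + w)}"
            proof
              fix w assume "w \<in> suspects n A3"
              with sus3 sus1 obtain x where "x \<in> {u, v}" "?hv x = 0" "w = x \<or> w < n \<and> 1 < ?E (x * n + w)" by blast
              then show "w \<in> {w. w = u \<or> w = v \<or> S4 ''fu'' \<noteq> 0 \<and> w < n \<and> 0 < E' (u * n + w) \<or>
                S4 ''fv'' \<noteq> 0 \<and> w < n \<and> 0 < E' (v * n + w)}"
                using fu(1,2) E'_pos[of x w] by auto
            qed
            fix S5 ex4 c4 A4 \<tau>4
            assume regs5: "regs S5 = regs S4" "S5 ''hn'' = S4 ''hn''"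
              and A4: "A4 = A3(''excluded'' := ex4, ''c'' := c4)"
              and dyn4: "dyn n A4" and sus4: "suspects n A4 = {}"
              and t4: "\<tau>4 + low_out n A4 * (31 * (D + 1) + 20) \<le>
                \<tau>3 + 100 + 80 * (D + 1) + low_out n A3 * (31 * (D + 1) + 20)"
            have A4_simps: "A4 ''E'' = E'" "A4 ''len'' = len'" "A4 ''heavy'' = ?hv3" "A4 ''H'' = ?H3"
              "A4 ''row'' = A ''row''" "A4 ''rlen'' = A ''rlen''" "A4 ''excluded'' = ex4" "A4 ''c'' = c4"
              by (simp_all add: A4 A3_simps)
            have base4: "base n A4" using base3 by (simp add: A4)
            have regs5': "regs S5 = (n, lam, ins, u, v, Suc t)" using regs5 regs4' by simp
            show "wp W heavy_phase Q S5 A4 \<tau>4"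
            proof (rule wp_heavy_phase[OF base4 dyn4 _ _ regs5' uv(1,2)], unfold A4_simps regs5(2), rule hok3, rule rows3)
              fix S6 row rlen ex A5 \<tau>5
              assume regs6: "regs S6 = regs S5" "S6 ''hn'' = S4 ''hn''"
                and A5: "A5 = A4(''row'' := row, ''rlen'' := rlen, ''excluded'' := ex)"
                and rows5: "rows_ok n E' ?H3 ?hn3 row rlen {}"
                and ex_low: "\<And>y. y < n \<Longrightarrow> ?hv3 y = 0 \<Longrightarrow> ex y = ex4 y" and ex1: "\<And>y. y < n \<Longrightarrow> ex y \<le> 1"
                and greedy5: "greedy_ok n E' ?H3 ?hn3 c4 ex"
                and t5: "\<tau>5 \<le> \<tau>4 + 50 + 140 * ?hn3 + 30 * (\<Sum>i<?hn3. rlen (?H3 i))"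
              have A5_simps: "A5 ''E'' = E'" "A5 ''len'' = len'" "A5 ''heavy'' = ?hv3" "A5 ''H'' = ?H3"
                "A5 ''row'' = row" "A5 ''rlen'' = rlen" "A5 ''excluded'' = ex" "A5 ''c'' = c4"
                by (simp_all add: A5 A4_simps)
              have base5: "base n A5" using base4 by (simp add: A5 base_def)
              have low_ex: "y < n \<and> ?hv3 y = 0 \<and> ex y = 0 \<and> P \<longleftrightarrow> y < n \<and> ?hv3 y = 0 \<and> ex4 y = 0 \<and> P" for y P
                using ex_low[of y] by auto
              have dyn5: "dyn n A5"
              proof -
                have "count_ok n E' ?hv3 ex c4"
                  using dyn4 unfolding dyn_def count_ok_def A4_simps low_ex by blast
                moreover have "\<forall>x<n. ?hv3 x = 0 \<and> ex x = 0 \<longrightarrow> c4 x = 0"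
                  using dyn4 ex_low unfolding dyn_def A4_simps by auto
                ultimately show ?thesis using ex1 unfolding dyn_def A5_simps by (intro conjI allI impI) simp_all
              qed
              have sus5: "suspects n A5 = {}"
                using sus4 ex_low unfolding suspects_def A5_simps A4_simps by auto
              have "{x. x < n \<and> ?hv3 x = 0 \<and> ex x \<noteq> 0} = {x. x < n \<and> ?hv3 x = 0 \<and> ex4 x \<noteq> 0}"
                using ex_low by auto
              then have lo5: "low_out n A5 = low_out n A4"
                unfolding low_out_def A5_simps A4_simps by simp
              have "invariant (Suc t) G' S6 A5"
                using regs6 regs5' base5 dyn5 sus5 graph' hok3 rows5 greedy5 short3 few3
                unfolding invariant_def A5_simps by (simp add: regs_def)
              moreover have "\<tau>5 + low_out n A5 * (31 * D + 51) \<le>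
                \<tau> + low_out n A * (31 * D + 51) + 800 + 210 * D + 140 * S6 ''hn'' + 30 * (lam * S6 ''hn'')"
              proof -
                have sum: "(\<Sum>i<?hn3. rlen (?H3 i)) \<le> lam * ?hn3"
                  by (rule rows_sum_le[OF graph' hok3 rows5 arb])
                have "low_out n A3 \<le> low_out n A + 2" using lo3 lo1 by simp
                \<comment> \<open>The two units of potential created by detaching cost
                  \<open>62 * D + 102\<close>. Together with \<open>62 * D\<close> for detaching
                  itself and \<open>80 * D\<close> for the repair, the coefficient of
                  \<open>D\<close> is 204, below the 210 claimed.\<close>
                then have "low_out n A3 * (31 * D + 51) \<le> (low_out n A + 2) * (31 * D + 51)"
                  by (rule mult_le_mono1)
                then have "low_out n A3 * (31 * D + 51) \<le> low_out n A * (31 * D + 51) + 62 * D + 102"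
                  by (simp add: add_mult_distrib)
                moreover have "31 * (D + 1) + 20 = 31 * D + 51" by simp
                note t4[unfolded this]
                ultimately show ?thesis using t1 t2 t3 t5 sum unfolding lo5 regs6(2) by simp
              qed
              ultimately show "Q S6 A5 \<tau>5" by (rule Q)
            qed
          qed
        qed
      qed
    qed
  qed
qed

section \<open>Sequences of updates\<close>

text \<open>Multiplying the bound on \<open>hn\<close> by \<open>sqrt lam\<close> gives
  \<open>lam * hn \<le> 4 * sqrt (lam * m)\<close>, and \<open>D + 1\<close> exceeds that root
  because its square exceeds \<open>lam * m\<close>.\<close>

lemma few_heavy_le:
  assumes "few_heavy lam t hn M" "t \<le> m" "\<And>x. x\<^sup>2 \<le> lam * m \<Longrightarrow> x \<le> D"
  shows "lam * hn \<le> 4 * (D + 1)"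
proof -
  have "real hn * sqrt lam \<le> 4 * sqrt t - real M / sqrt t" using assms(1) by (simp add: few_heavy_def)
  also have "\<dots> \<le> 4 * sqrt t" by simp
  also have "\<dots> \<le> 4 * sqrt m" using assms(2) by simp
  finally have "sqrt lam * (real hn * sqrt lam) \<le> sqrt lam * (4 * sqrt m)" by (intro mult_left_mono) auto
  also have "sqrt lam * (real hn * sqrt lam) = real (lam * hn)" by simp
  also have "sqrt lam * (4 * sqrt m) = 4 * sqrt (real (lam * m))" by (simp add: real_sqrt_mult)
  finally have 1: "real (lam * hn) \<le> 4 * sqrt (real (lam * m))" .
  have "lam * m < (D + 1)\<^sup>2" using assms(3)[of "D + 1"] by linarith
  then have "real (lam * m) < (real (D + 1))\<^sup>2" by (metis of_nat_less_iff of_nat_power)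
  then have "sqrt (real (lam * m)) < real (D + 1)"
    using real_sqrt_less_iff[of "real (lam * m)" "(real (D + 1))\<^sup>2"] by simp
  then have "4 * sqrt (real (lam * m)) \<le> 4 * real (D + 1)" by (intro mult_left_mono) auto
  with 1 have "real (lam * hn) \<le> 4 * real (D + 1)" by (rule order_trans)
  also have "\<dots> = real (4 * (D + 1))" by simp
  finally show ?thesis by (simp only: of_nat_le_iff)
qed

lemma update_step:
  assumes inv: "invariant t G (scalar s) (arr s)" and legal: "legal_update n G x"
    and t: "t < m" and arb: "arboricity {..<n} (apply_update x G) \<le> lam"
    and D: "\<And>x. x\<^sup>2 \<le> lam * m \<Longrightarrow> x \<le> D"
  obtains T s' where "exec W mis_update (feed x s) T s'"
    "invariant (Suc t) (apply_update x G) (scalar s') (arr s')"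
    "1 \<le> lam \<Longrightarrow> T + low_out n (arr s') * (31 * D + 51) \<le>
       low_out n (arr s) * (31 * D + 51) + 1500 * (D + 1)"
proof -
  obtain ins u v where x: "ins \<le> 1" "u < n" "v < n" "u \<noteq> v"
    "feed x s = \<lparr>scalar = (scalar s)(''insert'' := ins, ''u'' := u, ''v'' := v), arr = arr s\<rparr>"
    "apply_update x G = (if ins = 1 then insert {u, v} G else G - {{u, v}})"
  proof (cases x)
    case (Ins u v)
    with legal that[of 1 u v] show ?thesis by simp
  next
    case (Del u v)
    with legal have G: "{u, v} \<in> G" by simp
    moreover have "\<forall>e\<in>G. \<exists>a b. a < n \<and> b < n \<and> a \<noteq> b \<and> e = {a, b}"
      using inv unfolding invariant_def graph_ok_def by blast
    ultimately obtain a b where "a < n" "b < n" "a \<noteq> b" "{u, v} = {a, b}" by blast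
    then have "u < n \<and> v < n \<and> u \<noteq> v" by (auto simp: doubleton_eq_iff)
    with Del that[of 0 u v] show ?thesis by simp
  qed
  have "wp W mis_update (\<lambda>S' A' \<tau>'. invariant (Suc t) (apply_update x G) S' A' \<and>
      \<tau>' + low_out n A' * (31 * D + 51) \<le>
         0 + low_out n (arr s) * (31 * D + 51) + 800 + 210 * D + 140 * S' ''hn'' + 30 * (lam * S' ''hn''))
      (scalar (feed x s)) (arr (feed x s)) 0"
    by (rule wp_mis_update[where D = D, OF _ x(1-4) _ x(6) t arb D])
      (use inv x(5) in simp_all)
  moreover have feed_eq: "\<lparr>scalar = scalar (feed x s), arr = arr (feed x s)\<rparr> = feed x s" by simp
  ultimately obtain T S' A' where e: "exec W mis_update (feed x s) T \<lparr>scalar = S', arr = A'\<rparr>"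
    and inv': "invariant (Suc t) (apply_update x G) S' A'"
    and T: "T + low_out n A' * (31 * D + 51) \<le>
         low_out n (arr s) * (31 * D + 51) + 800 + 210 * D + 140 * S' ''hn'' + 30 * (lam * S' ''hn'')"
    unfolding wp_def feed_eq by auto
  have "T + low_out n A' * (31 * D + 51) \<le>
       low_out n (arr s) * (31 * D + 51) + 1500 * (D + 1)" if lam: "1 \<le> lam"
  proof -
    have "few_heavy lam (Suc t) (S' ''hn'') (mass n (A' ''heavy'') (A' ''len''))"
      using inv' unfolding invariant_def by blast
    then have "lam * S' ''hn'' \<le> 4 * (D + 1)" by (rule few_heavy_le) (use t D in auto)
    moreover have "S' ''hn'' \<le> lam * S' ''hn''" using lam by simp
    \<comment> \<open>The heavy phase contributes at most
      \<open>170 * 4 * (D + 1) = 680 * (D + 1)\<close>, and \<open>800 + 680\<close> is below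
      1500.\<close>
    moreover have "a \<le> b + 1500 * (D + 1)" if "h \<le> 4 * (D + 1)" "k \<le> h" "a \<le> b + 800 + 210 * D + 140 * k + 30 * h"
      for a b h k :: nat
      using that by simp
    ultimately show ?thesis using T by blast
  qed
  with e inv' that show ?thesis by simp
qed

lemma held_set_mis:
  assumes "invariant t G (scalar s) (arr s)"
  shows "maximal_independent_set {..<n} G (held_set n s)"
  using invariant_mis[OF assms] by (simp add: held_set_def)

text \<open>The potential telescopes over the sequence. The final length \<open>m\<close> and the
  bound \<open>D\<close> are fixed in the analysis, whereas the program only knows
  \<open>t\<close>.\<close>

lemma serve_updates:
  assumes "invariant t G (scalar s) (arr s)" and "t + length us \<le> m"
    and "\<forall>i<length us. legal_update n (fold apply_update (take i us) G) (us ! i)"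
    and "\<forall>i\<le>length us. arboricity {..<n} (fold apply_update (take i us) G) \<le> lam"
    and D: "\<And>x. x\<^sup>2 \<le> lam * m \<Longrightarrow> x \<le> D"
  shows "\<exists>T ss. serve W mis_update s us T ss \<and>
    (\<forall>i<length us. maximal_independent_set {..<n} (fold apply_update (take (Suc i) us) G) (held_set n (ss ! i))) \<and>
    (1 \<le> lam \<longrightarrow> T \<le> low_out n (arr s) * (31 * D + 51) + length us * (1500 * (D + 1)))"
  using assms(1-4)
proof (induction us arbitrary: t G s)
  case Nil
  then show ?case by (auto intro: serve_Nil)
next
  case (Cons x us)
  let ?G = "apply_update x G"
  have legal: "legal_update n G x" using Cons.prems(3)[rule_format, of 0] by simp
  have arb: "arboricity {..<n} ?G \<le> lam" using Cons.prems(4)[rule_format, of 1] by simp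
  have t: "t < m" using Cons.prems(2) by simp
  obtain T1 s' where e: "exec W mis_update (feed x s) T1 s'" and inv': "invariant (Suc t) ?G (scalar s') (arr s')"
    and T1: "1 \<le> lam \<Longrightarrow> T1 + low_out n (arr s') * (31 * D + 51) \<le>
       low_out n (arr s) * (31 * D + 51) + 1500 * (D + 1)"
    using update_step[OF Cons.prems(1) legal t arb D] by blast
  have "\<exists>T ss. serve W mis_update s' us T ss \<and>
    (\<forall>i<length us. maximal_independent_set {..<n} (fold apply_update (take (Suc i) us) ?G) (held_set n (ss ! i))) \<and>
    (1 \<le> lam \<longrightarrow> T \<le> low_out n (arr s') * (31 * D + 51) + length us * (1500 * (D + 1)))"
  proof (rule Cons.IH[OF inv'])
    show "Suc t + length us \<le> m" using Cons.prems(2) by simp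
    show "\<forall>i<length us. legal_update n (fold apply_update (take i us) ?G) (us ! i)"
    proof (intro allI impI)
      fix i assume "i < length us"
      then show "legal_update n (fold apply_update (take i us) ?G) (us ! i)"
        using Cons.prems(3)[rule_format, of "Suc i"] by simp
    qed
    show "\<forall>i\<le>length us. arboricity {..<n} (fold apply_update (take i us) ?G) \<le> lam"
    proof (intro allI impI)
      fix i assume "i \<le> length us"
      then show "arboricity {..<n} (fold apply_update (take i us) ?G) \<le> lam"
        using Cons.prems(4)[rule_format, of "Suc i"] by simp
    qed
  qed
  then obtain T2 ss where ss: "serve W mis_update s' us T2 ss"
    "\<forall>i<length us. maximal_independent_set {..<n} (fold apply_update (take (Suc i) us) ?G) (held_set n (ss ! i))"
    "1 \<le> lam \<longrightarrow> T2 \<le> low_out n (arr s') * (31 * D + 51) + length us * (1500 * (D + 1))" by blast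
  have "maximal_independent_set {..<n} (fold apply_update (take (Suc i) (x # us)) G) (held_set n ((s' # ss) ! i))"
    if "i < length (x # us)" for i
    using that ss(2) held_set_mis[OF inv'] by (cases i) auto
  moreover have "1 \<le> lam \<longrightarrow> T1 + T2 \<le> low_out n (arr s) * (31 * D + 51) + length (x # us) * (1500 * (D + 1))"
    using T1 ss(3) by auto
  ultimately show ?case using serve_Cons[OF e ss(1)] by blast
qed

end

text \<open>The first legal update inserts an edge, and the two vertices of a single edge already
  force arboricity 1. For \<open>lam = 0\<close> the number of heavy vertices could not be bounded
  through \<open>lam * hn\<close>.\<close>

lemma arboricity_pos:
  assumes "legal_updates n us" "us \<noteq> []" "\<forall>i\<le>length us. arboricity {..<n} (edges_after (take i us)) \<le> lam"
  shows "1 \<le> lam"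
proof -
  obtain x ys where us: "us = x # ys" using assms(2) by (cases us) auto
  then have "legal_update n {} x"
    using assms(1)[unfolded legal_updates_def, rule_format, of 0] by (simp add: edges_after_def)
  then obtain u v where x: "x = Ins u v" "u < n" "v < n" "u \<noteq> v" by (cases x) auto
  have "arboricity {..<n} {{u, v}} \<le> lam"
    using assms(3)[rule_format, of 1] us x by (simp add: edges_after_def)
  then have "card (induced_edges {{u, v}} {u, v}) \<le> lam * (card {u, v} - 1)"
    by (intro induced_edges_le_arboricity) (use x in auto)
  moreover have "induced_edges {{u, v}} {u, v} = {{u, v}}" by (auto simp: induced_edges_def)
  ultimately show ?thesis using x by simp
qed

theorem theorem18:
  shows "\<exists>(A :: dyn_alg) (C :: real) (k :: nat). C > 0 \<and>
    (\<forall>(n :: nat) (lam :: nat) (us :: edge_update list).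
      legal_updates n us \<longrightarrow>
      (\<forall>i \<le> length us. arboricity {..<n} (edges_after (take i us)) \<le> lam) \<longrightarrow>
      (\<exists>(T :: nat) (ss :: state list).
        run ((n + lam + length us + 2) ^ k) A n lam us T ss \<and>
        (\<forall>i \<le> length us.
          maximal_independent_set {..<n} (edges_after (take i us)) (held_set n (ss ! i))) \<and>
        (let m = length us in
          m \<ge> 2 \<longrightarrow>
          real T / real m \<le> C * (sqrt (real m * log 2 (real m)) * real lam powr (3 / 2)))))"
proof (rule exI[of _ "\<lparr>init_com = Skip, update_com = mis_update\<rparr>"], rule exI[of _ "3001 :: real"],
    rule exI[of _ "2 :: nat"], intro conjI allI impI)
  fix n lam :: nat and us :: "edge_update list"
  assume legal: "legal_updates n us" and arb: "\<forall>i\<le>length us. arboricity {..<n} (edges_after (take i us)) \<le> lam"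
  define m where "m = length us"
  define D where "D = nat \<lfloor>sqrt (real (lam * m))\<rfloor>"
  let ?W = "(n + lam + length us + 2) ^ 2" and ?s = "start_state n lam"
  interpret word_size ?W n lam m
    by standard (simp_all add: m_def power2_eq_square algebra_simps)
  have D: "x \<le> D" if "x\<^sup>2 \<le> lam * m" for x
  proof -
    have "(real x)\<^sup>2 \<le> real (lam * m)" using that by (metis of_nat_le_iff of_nat_power)
    then have "real x \<le> sqrt (real (lam * m))" by (rule real_le_rsqrt)
    then show ?thesis unfolding D_def by (rule le_nat_floor)
  qed
  have "0 + length us \<le> m" by (simp add: m_def)
  from serve_updates[OF invariant_start this _ _ D]
  obtain T ss where ss: "serve ?W mis_update ?s us T ss"
    "\<And>i. i < length us \<Longrightarrow> maximal_independent_set {..<n} (edges_after (take (Suc i) us)) (held_set n (ss ! i))"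
    "1 \<le> lam \<Longrightarrow> T \<le> low_out n (arr ?s) * (31 * D + 51) + m * (1500 * (D + 1))"
    using legal arb unfolding legal_updates_def edges_after_def m_def by blast
  \<comment> \<open>Every vertex is in the set at the start, so no potential has to be paid for
    initially.\<close>
  have "low_out n (arr ?s) = 0" by (simp add: low_out_def start_state_def)
  with ss(3) have T: "T \<le> m * (1500 * (D + 1))" if "1 \<le> lam" using that by simp
  have run: "run ?W \<lparr>init_com = Skip, update_com = mis_update\<rparr> n lam us (1 + T) (?s # ss)"
    unfolding run_def using exec_Skip ss(1) by force
  have mis: "maximal_independent_set {..<n} (edges_after (take i us)) (held_set n ((?s # ss) ! i))"
    if "i \<le> length us" for i
    using that ss(2) held_set_mis[OF invariant_start] by (cases i) (auto simp: edges_after_def)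
  have time: "real (1 + T) / real m \<le> 3001 * (sqrt (real m * log 2 (real m)) * real lam powr (3 / 2))"
    if m: "2 \<le> m"
  proof -
    have lam: "1 \<le> lam" by (rule arboricity_pos[OF legal _ arb]) (use m m_def in auto)
    define r where "r = sqrt (real (lam * m))"
    have "1 * 1 \<le> lam * m" using lam m by (intro mult_le_mono) auto
    then have "real 1 \<le> real (lam * m)" unfolding of_nat_le_iff by simp
    then have r: "1 \<le> r" by (simp only: r_def of_nat_1 real_sqrt_ge_1_iff)
    have "real D \<le> r" unfolding D_def r_def[symmetric] using r by linarith
    have "real (1 + T) \<le> 1 + real m * (1500 * (real D + 1))"
      using T[OF lam] by (metis (mono_tags, opaque_lifting) add_left_mono of_nat_1 of_nat_add of_nat_le_iff of_nat_mult of_nat_numeral)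
    \<comment> \<open>From \<open>1 \<le> r\<close> follows \<open>D + 1 \<le> 2 * r\<close>, and
      \<open>m * r\<close> absorbs the single step of the initialisation. Hence
      \<open>3001 = 1 + 2 * 1500\<close>.\<close>
    also have "\<dots> \<le> real m * r + real m * (1500 * (2 * r))"
    proof (rule add_mono)
      have "1 * 1 \<le> real m * r" using m r by (intro mult_mono) auto
      then show "1 \<le> real m * r" by simp
      show "real m * (1500 * (real D + 1)) \<le> real m * (1500 * (2 * r))"
        using r \<open>real D \<le> r\<close> by (intro mult_left_mono) auto
    qed
    also have "\<dots> = real m * (3001 * r)" by (simp add: algebra_simps)
    finally have "real (1 + T) / real m \<le> 3001 * r" using m by (simp add: divide_le_eq mult.commute)
    also have "r = sqrt m * real lam powr (1 / 2)" by (simp add: r_def real_sqrt_mult powr_half_sqrt)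
    \<comment> \<open>The bound obtained is stronger than the one claimed. Weakening it uses
      \<open>2 \<le> m\<close>, which makes the logarithm at least 1, and
      \<open>1 \<le> lam\<close>.\<close>
    also have "3001 * \<dots> \<le> 3001 * (sqrt (real m * log 2 (real m)) * real lam powr (3 / 2))"
    proof (intro mult_left_mono mult_mono)
      have "1 \<le> log 2 (real m)" using m by (simp add: le_log_iff)
      then have "real m * 1 \<le> real m * log 2 (real m)" by (intro mult_left_mono) auto
      then show "sqrt (real m) \<le> sqrt (real m * log 2 (real m))" by simp
      then show "0 \<le> sqrt (real m * log 2 (real m))" using real_sqrt_ge_zero[of "real m"] by linarith
      show "real lam powr (1 / 2) \<le> real lam powr (3 / 2)" using lam by (intro powr_mono) auto
    qed auto
    finally show ?thesis .
  qed
  show "\<exists>T ss. run ?W \<lparr>init_com = Skip, update_com = mis_update\<rparr> n lam us T ss \<and>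
      (\<forall>i\<le>length us. maximal_independent_set {..<n} (edges_after (take i us)) (held_set n (ss ! i))) \<and>
      (let m = length us in m \<ge> 2 \<longrightarrow>
          real T / real m \<le> 3001 * (sqrt (real m * log 2 (real m)) * real lam powr (3 / 2)))"
    using run mis time unfolding Let_def m_def by blast
qed simp

end
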